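(* Let $(\Omega,\nu)$ be an atomless Borel probability space and $W:\Omega\times\Omega\to[0,1]$ a graphon. Then: (a) For every sequence of finite graphs $(H_n)$ that converges to $W$ in the cut-distance we have $\chi(W)\le\liminf_{n\to\infty}\chi(H_n)$. (b) For the sequence $(G_n)$ with $G_n\sim\mathbb G(n,W)$ we have $\chi(W)=\lim_{n\to\infty}\chi(G_n)$ almost surely.
   Context: A graphon is a symmetric measurable $W:\Omega\times\Omega\to[0,1]$. A measurable set $A$ is independent in $W$ if $W=0$ a.e. on $A\times A$. A proper coloring of $W$ with $k$ colors is a measurable $f:\Omega\to[k]$ such that each $f^{-1}(i)$ is independent in $W$; $\chi(W)$ is the least such $k$ ($\infty$ if none exists). Convergence of graphs to a graphon in cut-distance is the standard notion (via graphon representations of the graphs). $\mathbb G(n,W)$ is the $W$-random graph on $[n]$: sample $x_1,\dots,x_n$ independently from $\nu$ and join $i,j$ independently with probability $W(x_i,x_j)$. *)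

theory Defs
  imports "HOL-Probability.Probability" "Graph_Theory.Pair_Digraph"
begin

text \<open>
  A ``Borel probability space'' is a standard Borel space with a probability measure: its
  measurable sets are the Borel sets of some Polish topology on the ground set.
\<close>

definition standard_borel :: "'a measure \<Rightarrow> bool" where
  "standard_borel M \<longleftrightarrow>
     (\<exists>T. completely_metrizable_space T \<and> second_countable T \<and> topspace T = space M \<and>
          sets M = sigma_sets (topspace T) {U. openin T U})"

definition atomless :: "'a measure \<Rightarrow> bool" where
  "atomless M \<longleftrightarrow>
     (\<forall>A\<in>sets M. 0 < emeasure M A \<longrightarrow>
        (\<exists>B\<in>sets M. B \<subseteq> A \<and> 0 < emeasure M B \<and> emeasure M B < emeasure M A))"

definition graphon :: "'a measure \<Rightarrow> ('a \<times> 'a \<Rightarrow> real) \<Rightarrow> bool" where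
  "graphon M W \<longleftrightarrow>
     W \<in> borel_measurable (M \<Otimes>\<^sub>M M) \<and>
     (\<forall>x\<in>space M. \<forall>y\<in>space M. W (x, y) = W (y, x) \<and> 0 \<le> W (x, y) \<and> W (x, y) \<le> 1)"

definition independent_in :: "'a measure \<Rightarrow> ('a \<times> 'a \<Rightarrow> real) \<Rightarrow> 'a set \<Rightarrow> bool" where
  "independent_in M W A \<longleftrightarrow>
     A \<in> sets M \<and> (AE z in M \<Otimes>\<^sub>M M. z \<in> A \<times> A \<longrightarrow> W z = 0)"

definition graphon_coloring ::
    "'a measure \<Rightarrow> ('a \<times> 'a \<Rightarrow> real) \<Rightarrow> nat \<Rightarrow> ('a \<Rightarrow> nat) \<Rightarrow> bool" where
  "graphon_coloring M W k f \<longleftrightarrow>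
     f \<in> measurable M (count_space {1..k}) \<and>
     (\<forall>i\<in>{1..k}. independent_in M W (f -` {i} \<inter> space M))"

text \<open>The infimum of the empty set is \<^term>\<open>\<infinity>::enat\<close>.\<close>

definition graphon_chi :: "'a measure \<Rightarrow> ('a \<times> 'a \<Rightarrow> real) \<Rightarrow> enat" where
  "graphon_chi M W = Inf {enat k | k. \<exists>f. graphon_coloring M W k f}"

text \<open>
  A finite simple graph is a \<^locale>\<open>pair_graph\<close>: finitely many vertices and a symmetric,
  loop-free arc relation in which each edge occurs in both orientations.
\<close>

definition graph_coloring :: "'v pair_pre_digraph \<Rightarrow> nat \<Rightarrow> ('v \<Rightarrow> nat) \<Rightarrow> bool" where
  "graph_coloring G k c \<longleftrightarrow>
     c ` pverts G \<subseteq> {1..k} \<and> (\<forall>(u, v)\<in>parcs G. c u \<noteq> c v)"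

definition graph_chi :: "'v pair_pre_digraph \<Rightarrow> enat" where
  "graph_chi G = Inf {enat k | k. \<exists>c. graph_coloring G k c}"

text \<open>
  A graphon representation of a graph splits the ground space into measurable parts of equal
  measure, one for each vertex; \<open>p\<close> sends a point to the vertex of its part. A graph without
  vertices has no representation.
\<close>

definition graphon_rep ::
    "'a measure \<Rightarrow> 'v pair_pre_digraph \<Rightarrow> ('a \<times> 'a \<Rightarrow> real) \<Rightarrow> bool" where
  "graphon_rep M G U \<longleftrightarrow>
     (\<exists>p \<in> measurable M (count_space (pverts G)).
        (\<forall>v\<in>pverts G. measure M (p -` {v} \<inter> space M) = 1 / real (card (pverts G))) \<and>
        U = (\<lambda>(x, y). if (p x, p y) \<in> parcs G then 1 else 0))"

definition cut_norm :: "'a measure \<Rightarrow> ('a \<times> 'a \<Rightarrow> real) \<Rightarrow> real" where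
  "cut_norm M U =
     (SUP (A, B) \<in> sets M \<times> sets M. \<bar>set_lebesgue_integral (M \<Otimes>\<^sub>M M) (A \<times> B) U\<bar>)"

text \<open>Invertible measure preserving maps.\<close>

definition automorphisms :: "'a measure \<Rightarrow> ('a \<Rightarrow> 'a) set" where
  "automorphisms M =
     {\<phi> \<in> measurable M M.
        bij_betw \<phi> (space M) (space M) \<and> inv_into (space M) \<phi> \<in> measurable M M \<and>
        distr M M \<phi> = M}"

definition cut_dist :: "'a measure \<Rightarrow> ('a \<times> 'a \<Rightarrow> real) \<Rightarrow> ('a \<times> 'a \<Rightarrow> real) \<Rightarrow> real" where
  "cut_dist M U W =
     (INF \<phi> \<in> automorphisms M. cut_norm M (\<lambda>(x, y). U (x, y) - W (\<phi> x, \<phi> y)))"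

text \<open>
  Any two representations of the same graph are at cut-distance zero on an atomless standard
  Borel space, so the choice of the representations below is immaterial.
\<close>

definition graphs_converge_cut ::
    "'a measure \<Rightarrow> (nat \<Rightarrow> 'v pair_pre_digraph) \<Rightarrow> ('a \<times> 'a \<Rightarrow> real) \<Rightarrow> bool" where
  "graphs_converge_cut M H W \<longleftrightarrow>
     (\<exists>U. (\<forall>n. graphon_rep M (H n) (U n)) \<and> (\<lambda>n. cut_dist M (U n) W) \<longlonglongrightarrow> 0)"

definition vertex_pairs :: "nat \<Rightarrow> (nat \<times> nat) set" where
  "vertex_pairs n = {(i, j). 1 \<le> i \<and> i < j \<and> j \<le> n}"

definition graph_of_indicator :: "nat \<Rightarrow> (nat \<times> nat \<Rightarrow> bool) \<Rightarrow> nat pair_pre_digraph" where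
  "graph_of_indicator n e =
     (let E = {ij \<in> vertex_pairs n. e ij} in \<lparr>pverts = {1..n}, parcs = E \<union> E\<inverse>\<rparr>)"

text \<open>
  The law of the \<open>W\<close>-random graph on \<open>[n]\<close>: sample the points \<open>x i\<close> independently from \<open>M\<close>, then
  decide each pair \<open>i < j\<close> by an independent Bernoulli trial with parameter \<open>W (x i, x j)\<close>.
\<close>

definition W_random_graph ::
    "'a measure \<Rightarrow> ('a \<times> 'a \<Rightarrow> real) \<Rightarrow> nat \<Rightarrow> nat pair_pre_digraph measure" where
  "W_random_graph M W n =
     (\<Pi>\<^sub>M i\<in>{1..n}. M) \<bind>
       (\<lambda>x. measure_pmf (map_pmf (graph_of_indicator n)
              (Pi_pmf (vertex_pairs n) False (\<lambda>(i, j). bernoulli_pmf (W (x i, x j))))))"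

end

theory Submission
  imports Defs
begin

text \<open>
  Both parts rest on one compactness statement: if almost every finite tuple of points can be
  properly colored with \<open>m\<close> colors (no two points of the same color with \<open>W \<noteq> 0\<close>), then \<open>W\<close> has a
  proper \<open>m\<close>-coloring. Call a finite sequence of colored points good if for every \<open>k\<close> its coloring
  extends to almost every \<open>k\<close>-tuple of further points. If a good sequence is given, almost every
  further point has a color that keeps it good; otherwise, independent blocks of points that
  exclude one color each would exclude all colors at once. Let \<open>A\<^sub>i\<close> be the set of points with no
  neighbor of color \<open>i\<close> in the sequence, and extend the sequence greedily, removing nearly as much as
  possible from the sets \<open>A\<^sub>i\<close> in each step. In the limit almost every point \<open>y\<close> lies in some \<open>A\<^sub>i\<close> such
  that the neighborhood of \<open>y\<close> meets \<open>A\<^sub>i\<close> in a null set, and the least such \<open>i\<close> is a proper coloring.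

  For (a), colorings of graphs close to \<open>W\<close> give measurable partitions with almost no \<open>W\<close>-mass inside
  the classes; along a sequence with summable errors, almost every pair with \<open>W \<noteq> 0\<close> is eventually
  separated, so almost every finite tuple is properly colored by some member of the sequence. For (b),
  if \<open>W\<close> has no \<open>m\<close>-coloring, then for some \<open>k\<close> the random graph on \<open>k\<close> vertices is \<open>m\<close>-colorable with
  probability less than 1. Disjoint blocks of vertices are independent, so this probability decays
  exponentially in the number of vertices, and Borel--Cantelli applies whatever the coupling of the
  random graphs is.
\<close>

section \<open>Chromatic numbers as least admissible numbers of colors\<close>

text \<open>An infimum in \<open>enat\<close> over a nonempty set is attained, and monotonicity
  moves the attained value up to \<open>m\<close>. Over the empty set it is infinite.\<close>

lemma Inf_enat_le_iff:
  assumes "\<And>j k. P j \<Longrightarrow> j \<le> k \<Longrightarrow> P k"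
  shows "Inf {enat k | k. P k} \<le> enat m \<longleftrightarrow> P m"
proof
  assume le: "Inf {enat k | k. P k} \<le> enat m"
  have ne: "{enat k | k. P k} \<noteq> {}"
  proof
    assume "{enat k | k. P k} = {}"
    with le have "Inf {} \<le> enat m" by metis
    then show False by (simp add: Inf_enat_def)
  qed
  then have "Inf {enat k | k. P k} \<in> {enat k | k. P k}"
    unfolding Inf_enat_def by (auto intro: LeastI)
  then obtain k where "P k" "Inf {enat k | k. P k} = enat k"
    by auto
  with le assms show "P m"
    by auto
qed (auto intro!: Inf_lower)

lemma graphon_coloring_mono:
  assumes "graphon_coloring M W j f" "j \<le> k"
  shows "graphon_coloring M W k f"
proof -
  have f: "f \<in> measurable M (count_space {1..j})"
    and ind: "\<And>i. i \<in> {1..j} \<Longrightarrow> independent_in M W (f -` {i} \<inter> space M)"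
    using assms(1) by (auto simp: graphon_coloring_def)
  have "f \<in> measurable M (count_space {1..k})"
    using assms(2) by (intro measurable_compose[OF f]) auto
  moreover have "independent_in M W (f -` {i} \<inter> space M)" if "i \<in> {1..k}" for i
  proof (cases "i \<in> {1..j}")
    case False
    then have "f -` {i} \<inter> space M = {}"
      using measurable_space[OF f] by auto
    then show ?thesis by (simp add: independent_in_def)
  qed (use ind in auto)
  ultimately show ?thesis
    by (auto simp: graphon_coloring_def)
qed

lemma graphon_chi_le_iff: "graphon_chi M W \<le> enat m \<longleftrightarrow> (\<exists>f. graphon_coloring M W m f)"
  unfolding graphon_chi_def by (rule Inf_enat_le_iff) (auto intro: graphon_coloring_mono)

lemma graph_coloring_mono: "graph_coloring G j c \<Longrightarrow> j \<le> k \<Longrightarrow> graph_coloring G k c"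
  unfolding graph_coloring_def by (meson atLeastatMost_subset_iff order_refl order_trans)

lemma graph_chi_le_iff: "graph_chi G \<le> enat m \<longleftrightarrow> (\<exists>c. graph_coloring G m c)"
  unfolding graph_chi_def by (rule Inf_enat_le_iff) (auto intro: graph_coloring_mono)

section \<open>Coloring from finite samples\<close>

context prob_space
begin

text \<open>The sum over the colors of the measures of the sets \<open>A\<close> is a nonnegative
  potential that falls by \<open>dec\<close> in each step, so the falls tend to 0. A point that a
  color keeps good infinitely often could have been chosen at each of those times. Hence its
  neighborhood meets the limit set of that color in measure at most twice the fall, that is, in a
  null set.\<close>

lemma greedy_graphon_coloring:
  fixes W :: "'a \<times> 'a \<Rightarrow> real" and Good :: "('a \<times> nat) list \<Rightarrow> bool"
  assumes W[measurable]: "W \<in> borel_measurable (M \<Otimes>\<^sub>M M)"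
    and Nil: "Good []"
    and step: "\<And>l. Good l \<Longrightarrow> AE x in M. \<exists>i\<in>{1..m}. Good (l @ [(x, i)])"
    and proper: "\<And>l x y i. Good (l @ [(y, i)]) \<Longrightarrow> (x, i) \<in> set l \<Longrightarrow> W (x, y) = 0"
  shows "\<exists>f. graphon_coloring M W m f"
proof -
  define N where "N x = {y \<in> space M. W (x, y) \<noteq> 0}" for x
  define A where "A l i = {y \<in> space M. \<forall>(x, j)\<in>set l. j = i \<longrightarrow> W (x, y) = 0}" for l and i :: nat
  \<comment> \<open>The measure that the set of color \<open>snd p\<close> loses when
    \<open>p\<close> is appended.\<close>
  define dec where "dec l p = measure M (A l (snd p) \<inter> N (fst p))" for l p
  define cand where "cand l p \<longleftrightarrow> fst p \<in> space M \<and> snd p \<in> {1..m} \<and> Good (l @ [p])" for l p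
  have N[measurable]: "N x \<in> sets M" if "x \<in> space M" for x
    unfolding N_def using that by measurable
  have A: "A l i \<in> sets M" if "fst ` set l \<subseteq> space M" for l i
    using that
  proof (induction l)
    case (Cons p l)
    have "A (p # l) i = (if snd p = i then A l i - N (fst p) else A l i)"
      by (auto simp: A_def N_def case_prod_beta)
    then show ?case
      using Cons by auto
  qed (simp add: A_def)
  have ex_cand: "\<exists>p. cand l p" if "Good l" for l
  proof -
    have "AE x in M. x \<in> space M \<and> (\<exists>i\<in>{1..m}. Good (l @ [(x, i)]))"
      using step[OF that] by auto
    then obtain x where "x \<in> space M" "\<exists>i\<in>{1..m}. Good (l @ [(x, i)])"
      using eventually_happens[where net="ae_filter M"] ae_filter_bot by blast
    then obtain i where "i \<in> {1..m}" "Good (l @ [(x, i)])" by blast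
    with \<open>x \<in> space M\<close> have "cand l (x, i)" by (simp add: cand_def)
    then show ?thesis ..
  qed
  \<comment> \<open>The supremum of the losses need not be attained; half of it is enough. If it is
    0, any candidate serves.\<close>
  have "\<exists>p. cand l p \<and> (\<forall>p'. cand l p' \<longrightarrow> dec l p' \<le> 2 * dec l p)" if good: "Good l" for l
  proof -
    let ?D = "dec l ` {p. cand l p}"
    have bdd: "bdd_above ?D"
      by (rule bdd_aboveI[of _ 1]) (auto simp: dec_def)
    have up: "dec l p \<le> Sup ?D" if "cand l p" for p
      using that bdd by (auto intro: cSup_upper)
    obtain p0 where p0: "cand l p0"
      using ex_cand[OF good] by auto
    show ?thesis
    proof (cases "Sup ?D \<le> 0")
      case True
      have "dec l p' \<le> 2 * dec l p0" if "cand l p'" for p'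
      proof -
        have "0 \<le> dec l p0" by (simp add: dec_def)
        with up[OF that] True show ?thesis by linarith
      qed
      with p0 show ?thesis by blast
    next
      case False
      then have "Sup ?D / 2 < Sup ?D" by simp
      then obtain p where p: "cand l p" "Sup ?D / 2 < dec l p"
        using less_cSupE[of "Sup ?D / 2" ?D] p0 by blast
      have "dec l p' \<le> 2 * dec l p" if "cand l p'" for p'
        using up[OF that] p(2) by linarith
      with p show ?thesis by blast
    qed
  qed
  then have "\<forall>l. \<exists>p. Good l \<longrightarrow> cand l p \<and> (\<forall>p'. cand l p' \<longrightarrow> dec l p' \<le> 2 * dec l p)"
    by blast
  from choice[OF this] obtain ch where ch: "\<And>l. Good l \<Longrightarrow> cand l (ch l)"
      and ch_max: "\<And>l p. Good l \<Longrightarrow> cand l p \<Longrightarrow> dec l p \<le> 2 * dec l (ch l)"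
    by blast
  define L where "L n = ((\<lambda>l. l @ [ch l]) ^^ n) []" for n
  have L_Suc: "L (Suc n) = L n @ [ch (L n)]" for n
    by (simp add: L_def)
  have Good_L: "Good (L n)" for n
  proof (induction n)
    case (Suc n)
    then show ?case using ch[OF Suc] by (simp add: L_Suc cand_def)
  qed (simp add: L_def Nil)
  note cand_L = ch[OF Good_L]
  have L_space: "fst ` set (L n) \<subseteq> space M" for n
  proof (induction n)
    case (Suc n)
    then show ?case using cand_L[of n] by (auto simp: L_Suc cand_def)
  qed (simp add: L_def)
  note AL[measurable] = A[OF L_space]
  have A_Suc: "A (L (Suc n)) i =
      (if snd (ch (L n)) = i then A (L n) i - N (fst (ch (L n))) else A (L n) i)" for n i
    by (auto simp: A_def N_def L_Suc case_prod_beta)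
  have A_mono: "A (L n') i \<subseteq> A (L n) i" if "n \<le> n'" for n n' i
    using that by (induction rule: dec_induct) (auto simp: A_Suc split: if_splits)
  define s where "s n = (\<Sum>i\<in>{1..m}. measure M (A (L n) i))" for n
  define d where "d n = dec (L n) (ch (L n))" for n
  have "s (Suc n) = s n - d n" for n
  proof -
    let ?p = "ch (L n)"
    have p: "fst ?p \<in> space M" "snd ?p \<in> {1..m}"
      using cand_L[of n] by (auto simp: cand_def)
    have "measure M (A (L n) i - N (fst ?p)) = measure M (A (L n) i) - measure M (A (L n) i \<inter> N (fst ?p))" for i
      using p by (subst finite_measure_Diff') auto
    then have "measure M (A (L (Suc n)) i) =
        measure M (A (L n) i) - (if snd ?p = i then d n else 0)" for i
      by (auto simp: A_Suc d_def dec_def)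
    then show ?thesis
      using p by (simp add: s_def sum_subtractf)
  qed
  then have d: "d = (\<lambda>n. s n - s (Suc n))"
    by auto
  have d_nonneg: "0 \<le> d n" for n
    by (simp add: d_def dec_def)
  have "decseq s"
    using d_nonneg by (intro decseq_SucI) (simp add: d)
  moreover have "0 \<le> s n" for n
    by (auto simp: s_def intro: sum_nonneg)
  ultimately obtain t where t: "s \<longlonglongrightarrow> t"
    using decseq_convergent[of s 0] by blast
  then have d_lim: "d \<longlonglongrightarrow> 0"
    unfolding d using tendsto_diff[OF t LIMSEQ_Suc[OF t]] by simp
  define B where "B i = (\<Inter>n. A (L n) i)" for i
  have B[measurable]: "B i \<in> sets M" for i
    unfolding B_def by auto
  define R where "R i y \<longleftrightarrow> i \<in> {1..m} \<and> y \<in> B i \<and> measure M (B i \<inter> N y) = 0" for i y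
  have AE_R: "AE y in M. \<exists>i. R i y"
  proof -
    have "AE y in M. \<forall>n. \<exists>i\<in>{1..m}. Good (L n @ [(y, i)])"
      using step[OF Good_L] by (simp add: AE_all_countable)
    then show ?thesis
      using AE_space
    proof eventually_elim
      case (elim y)
      \<comment> \<open>The admissible color may vary with \<open>n\<close>; as there are finitely
        many, one of them recurs infinitely often.\<close>
      then have "\<exists>i\<in>{1..m}. \<exists>\<^sub>F n in sequentially. Good (L n @ [(y, i)])"
        by (intro frequently_bex_finite) (auto intro!: eventually_frequently)
      then obtain i where i: "i \<in> {1..m}" and fr: "\<exists>\<^sub>F n in sequentially. Good (L n @ [(y, i)])"
        by auto
      have in_A: "y \<in> A (L n) i" if "Good (L n @ [(y, i)])" for n
        using proper[OF that] elim(2) by (auto simp: A_def)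
      have "y \<in> A (L n) i" for n
      proof -
        obtain n' where "n' \<ge> n" "Good (L n' @ [(y, i)])"
          using fr by (auto simp: frequently_sequentially)
        then show ?thesis using in_A A_mono by blast
      qed
      then have yB: "y \<in> B i" by (auto simp: B_def)
      have bound: "measure M (B i \<inter> N y) \<le> 2 * d n" if "Good (L n @ [(y, i)])" for n
      proof -
        have "measure M (B i \<inter> N y) \<le> dec (L n) (y, i)"
          unfolding dec_def using elim(2) by (intro finite_measure_mono) (auto simp: B_def)
        also have "\<dots> \<le> 2 * d n"
          unfolding d_def using that i elim(2) by (intro ch_max Good_L) (auto simp: cand_def)
        finally show ?thesis .
      qed
      have "measure M (B i \<inter> N y) \<le> 0"
      proof (rule ccontr)
        assume "\<not> ?thesis"
        then have "0 < measure M (B i \<inter> N y)" by simp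
        moreover have "(\<lambda>n. 2 * d n) \<longlonglongrightarrow> 0"
          using tendsto_mult_left[OF d_lim, of 2] by simp
        ultimately have "eventually (\<lambda>n. 2 * d n < measure M (B i \<inter> N y)) sequentially"
          by (rule order_tendstoD(2)[rotated])
        from frequently_eventually_frequently[OF fr this]
        obtain n where "Good (L n @ [(y, i)])" "2 * d n < measure M (B i \<inter> N y)"
          using frequently_ex by blast
        with bound[of n] show False by linarith
      qed
      with yB i show ?case
        by (auto simp: R_def measure_le_0_iff)
    qed
  qed
  have [measurable]: "Measurable.pred M (R i)" for i
  proof -
    \<comment> \<open>The measure of a section of a measurable set depends measurably on its
      point.\<close>
    have "(\<lambda>y. measure M (Pair y -` {z \<in> space (M \<Otimes>\<^sub>M M). snd z \<in> B i \<and> W z \<noteq> 0})) \<in> borel_measurable M"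
      unfolding measure_def by (intro borel_measurable_enn2real measurable_emeasure_Pair) measurable
    moreover have "Pair y -` {z \<in> space (M \<Otimes>\<^sub>M M). snd z \<in> B i \<and> W z \<noteq> 0} = B i \<inter> N y"
      if "y \<in> space M" for y
      using that sets.sets_into_space[OF B] by (auto simp: N_def space_pair_measure)
    ultimately have [measurable]: "(\<lambda>y. measure M (B i \<inter> N y)) \<in> borel_measurable M"
      by (simp cong: measurable_cong)
    show ?thesis
      unfolding R_def by measurable
  qed
  \<comment> \<open>The default 1 is taken at most on a null set; it is a color because
    \<open>m \<ge> 1\<close>.\<close>
  define f where "f y = (if \<exists>i. R i y then LEAST i. R i y else 1)" for y
  have R_f: "R (f y) y" if "\<exists>i. R i y" for y
    using that by (auto simp: f_def intro: LeastI)
  have "m \<ge> 1"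
    using ex_cand[OF Nil] by (auto simp: cand_def)
  then have f_range: "f y \<in> {1..m}" for y
    using R_f[of y] by (cases "\<exists>i. R i y") (auto simp: R_def f_def)
  have f_UNIV[measurable]: "f \<in> measurable M (count_space UNIV)"
    unfolding f_def by measurable
  have "f \<in> measurable M (count_space {1..m})"
    using f_range measurable_sets[OF f_UNIV] by (auto simp: measurable_count_space_eq2)
  moreover have "independent_in M W (f -` {i} \<inter> space M)" (is "independent_in M W ?F") for i
  proof -
    interpret MM: pair_sigma_finite M M ..
    have F[measurable]: "?F \<in> sets M" by measurable
    \<comment> \<open>If \<open>f x = i\<close>, almost every \<open>y\<close> of color
      \<open>i\<close> lies in \<open>B i\<close>, which meets \<open>N x\<close> in a null
      set.\<close>
    have "AE x in M. AE y in M. (x, y) \<in> ?F \<times> ?F \<longrightarrow> W (x, y) = 0"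
      using AE_R AE_space
    proof eventually_elim
      case (elim x)
      show ?case
      proof (cases "f x = i")
        case True
        then have "measure M (B i \<inter> N x) = 0"
          using R_f elim by (auto simp: R_def)
        then have "AE y in M. y \<notin> B i \<inter> N x"
          using elim by (intro AE_not_in) (auto simp: null_sets_def emeasure_eq_measure)
        then show ?thesis
          using AE_R
        proof eventually_elim
          case (elim y)
          then show ?case using R_f[of y] by (auto simp: R_def N_def)
        qed
      qed auto
    qed
    then have "AE z in M \<Otimes>\<^sub>M M. z \<in> ?F \<times> ?F \<longrightarrow> W z = 0"
      by (intro MM.AE_pair_measure) auto
    then show ?thesis
      using F by (simp add: independent_in_def)
  qed
  ultimately show ?thesis
    by (auto simp: graphon_coloring_def)
qed

end

text \<open>
  Nested quantifiers in place of product measures spare all measurability conditions on the predicate.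
\<close>

primrec AE_iter :: "'a measure \<Rightarrow> nat \<Rightarrow> ('a list \<Rightarrow> bool) \<Rightarrow> bool" where
  "AE_iter M 0 P \<longleftrightarrow> P []"
| "AE_iter M (Suc k) P \<longleftrightarrow> (AE x in M. AE_iter M k (\<lambda>xs. P (x # xs)))"

lemma AE_iter_mono:
  assumes "AE_iter M k P" "\<And>xs. length xs = k \<Longrightarrow> P xs \<Longrightarrow> Q xs"
  shows "AE_iter M k Q"
  using assms
proof (induction k arbitrary: P Q)
  case (Suc k)
  from Suc.prems(1) show ?case
    unfolding AE_iter.simps by (rule eventually_mono) (erule Suc.IH, rule Suc.prems(2), simp_all)
qed simp

lemma AE_iter_add:
  "AE_iter M (j + k) P \<longleftrightarrow> AE_iter M j (\<lambda>xs. AE_iter M k (\<lambda>ys. P (xs @ ys)))"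
  by (induction j arbitrary: P) auto

text \<open>\<open>sorted_wrt\<close> compares each entry with the later ones only, so no entry is
  compared with itself.\<close>

definition proper_list :: "('a \<times> 'a \<Rightarrow> real) \<Rightarrow> ('a \<times> nat) list \<Rightarrow> bool" where
  "proper_list W l \<longleftrightarrow> sorted_wrt (\<lambda>(x, i) (y, j). i = j \<longrightarrow> W (x, y) = 0) l"

definition extendable :: "('a \<times> 'a \<Rightarrow> real) \<Rightarrow> nat \<Rightarrow> ('a \<times> nat) list \<Rightarrow> 'a list \<Rightarrow> bool" where
  "extendable W m l ys \<longleftrightarrow>
     (\<exists>cs. length cs = length ys \<and> set cs \<subseteq> {1..m} \<and> proper_list W (l @ zip ys cs))"

lemma extendable_Nil: "extendable W m l [] \<longleftrightarrow> proper_list W l"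
  by (simp add: extendable_def)

lemma extendable_Cons:
  "extendable W m l (x # ys) \<longleftrightarrow> (\<exists>i\<in>{1..m}. extendable W m (l @ [(x, i)]) ys)"
proof
  assume "extendable W m l (x # ys)"
  then obtain cs where "length cs = Suc (length ys)" "set cs \<subseteq> {1..m}"
      "proper_list W (l @ zip (x # ys) cs)"
    by (auto simp: extendable_def)
  then show "\<exists>i\<in>{1..m}. extendable W m (l @ [(x, i)]) ys"
    by (cases cs) (auto simp: extendable_def)
next
  assume "\<exists>i\<in>{1..m}. extendable W m (l @ [(x, i)]) ys"
  then obtain i cs where "i \<in> {1..m}" "length cs = length ys" "set cs \<subseteq> {1..m}"
      "proper_list W (l @ (x, i) # zip ys cs)"
    by (auto simp: extendable_def)
  then show "extendable W m l (x # ys)"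
    unfolding extendable_def by (intro exI[of _ "i # cs"]) auto
qed

text \<open>A sublist of a properly colored list is properly colored. The second conclusion drops a
  middle block, which lets blocks of the sample be judged separately.\<close>

lemma extendable_append:
  assumes "extendable W m l (xs @ ys)"
  shows "extendable W m l xs" "extendable W m l ys"
proof -
  obtain cs where cs: "length cs = length xs + length ys" "set cs \<subseteq> {1..m}"
      "proper_list W (l @ zip (xs @ ys) cs)"
    using assms by (auto simp: extendable_def)
  define as bs where "as = take (length xs) cs" and "bs = drop (length xs) cs"
  have split: "cs = as @ bs" "length as = length xs" "length bs = length ys"
    using cs(1) by (auto simp: as_def bs_def)
  have "sorted_wrt R (us @ vs @ ws) \<Longrightarrow> sorted_wrt R (us @ vs) \<and> sorted_wrt R (us @ ws)"
    for R and us vs ws :: "('a \<times> nat) list"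
    by (auto simp: sorted_wrt_append)
  then have "proper_list W (l @ zip xs as)" "proper_list W (l @ zip ys bs)"
    using cs(3) split unfolding proper_list_def by (metis zip_append)+
  then show "extendable W m l xs" "extendable W m l ys"
    using cs(2) split unfolding extendable_def by auto
qed

context prob_space
begin

lemma AE_iter_const: "AE_iter M k (\<lambda>_. P) \<longleftrightarrow> P"
  by (induction k) auto

lemma AE_iter_disj: "AE_iter M k (\<lambda>xs. P \<or> Q xs) \<longleftrightarrow> P \<or> AE_iter M k Q"
  by (cases P) (simp_all add: AE_iter_const)

text \<open>Disjoint blocks of sample points fail independently of each other.\<close>

lemma not_AE_iter_Bex:
  assumes "finite I" and "\<And>i. i \<in> I \<Longrightarrow> \<exists>k. \<not> AE_iter M k (P i)"
    and app: "\<And>i xs ys. P i (xs @ ys) \<Longrightarrow> P i xs \<and> P i ys"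
  shows "\<exists>k. \<not> AE_iter M k (\<lambda>xs. \<exists>i\<in>I. P i xs)"
  using assms(1,2)
proof (induction I rule: finite_induct)
  case empty
  show ?case by (auto simp: AE_iter_const)
next
  case (insert j I)
  then obtain k k' where k: "\<not> AE_iter M k (P j)" and k': "\<not> AE_iter M k' (\<lambda>xs. \<exists>i\<in>I. P i xs)"
    by blast
  have "\<not> AE_iter M (k + k') (\<lambda>xs. \<exists>i\<in>insert j I. P i xs)"
  proof
    assume "AE_iter M (k + k') (\<lambda>xs. \<exists>i\<in>insert j I. P i xs)"
    \<comment> \<open>The first block is used for the index \<open>j\<close>, the second for
      \<open>I\<close>. For the inner quantifier \<open>P j xs\<close> is a constant, so the
      disjunction splits.\<close>
    then have "AE_iter M k (\<lambda>xs. AE_iter M k' (\<lambda>ys. P j xs \<or> (\<exists>i\<in>I. P i ys)))"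
      unfolding AE_iter_add by (rule AE_iter_mono) (erule AE_iter_mono, use app in blast)
    then have "AE_iter M k (\<lambda>xs. AE_iter M k' (\<lambda>ys. \<exists>i\<in>I. P i ys) \<or> P j xs)"
      by (simp add: AE_iter_disj disj_commute)
    then show False
      using k k' by (simp add: AE_iter_disj)
  qed
  then show ?case ..
qed

text \<open>A priori the color of the next point depends on the length and on the further points. If
  every color failed at some length, concatenated blocks would make all of them fail at one
  length.\<close>

lemma graphon_coloring_of_finite:
  assumes W: "W \<in> borel_measurable (M \<Otimes>\<^sub>M M)"
    and fin: "\<And>k. AE_iter M k (extendable W m [])"
  shows "\<exists>f. graphon_coloring M W m f"
proof (rule greedy_graphon_coloring[OF W, where Good = "\<lambda>l. \<forall>k. AE_iter M k (extendable W m l)"])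
  fix l
  assume good: "\<forall>k. AE_iter M k (extendable W m l)"
  have "AE x in M. AE_iter M k (\<lambda>xs. \<exists>i\<in>{1..m}. extendable W m (l @ [(x, i)]) xs)" for k
    using good[rule_format, of "Suc k"] by (simp add: extendable_Cons)
  then have "AE x in M. \<forall>k. AE_iter M k (\<lambda>xs. \<exists>i\<in>{1..m}. extendable W m (l @ [(x, i)]) xs)"
    by (simp add: AE_all_countable)
  then show "AE x in M. \<exists>i\<in>{1..m}. \<forall>k. AE_iter M k (extendable W m (l @ [(x, i)]))"
  proof (rule eventually_mono)
    fix x
    assume x: "\<forall>k. AE_iter M k (\<lambda>xs. \<exists>i\<in>{1..m}. extendable W m (l @ [(x, i)]) xs)"
    show "\<exists>i\<in>{1..m}. \<forall>k. AE_iter M k (extendable W m (l @ [(x, i)]))"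
    proof (rule ccontr)
      assume "\<not> ?thesis"
      then have "\<exists>k. \<not> AE_iter M k (\<lambda>xs. \<exists>i\<in>{1..m}. extendable W m (l @ [(x, i)]) xs)"
        by (intro not_AE_iter_Bex) (auto dest: extendable_append)
      with x show False by blast
    qed
  qed
next
  fix l x y i
  assume "\<forall>k. AE_iter M k (extendable W m (l @ [(y, i)]))" "(x, i) \<in> set l"
  from this(1)[rule_format, of 0] this(2) show "W (x, y) = 0"
    by (auto simp: extendable_Nil proper_list_def sorted_wrt_append)
qed (use fin in auto)

lemma AE_iter_sorted_wrt:
  assumes "AE x in M. T x" and "AE x in M. AE y in M. R x y"
  shows "AE_iter M k (\<lambda>xs. (\<forall>x\<in>set xs. T x) \<and> sorted_wrt R xs)"
proof -
  \<comment> \<open>\<open>F\<close> collects the points drawn so far; the induction needs that each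
    of them is related to almost every further point.\<close>
  have "AE_iter M k (\<lambda>xs. (\<forall>x\<in>set xs. T x \<and> (\<forall>z\<in>F. R z x)) \<and> sorted_wrt R xs)"
    if "finite F" "\<forall>z\<in>F. AE y in M. R z y" for F
    using that
  proof (induction k arbitrary: F)
    case (Suc k)
    have "AE x in M. \<forall>z\<in>F. R z x"
      using Suc.prems by (intro AE_finite_allI) auto
    with assms show ?case
      unfolding AE_iter.simps
    proof eventually_elim
      case (elim x)
      then have "AE_iter M k (\<lambda>xs. (\<forall>y\<in>set xs. T y \<and> (\<forall>z\<in>insert x F. R z y)) \<and> sorted_wrt R xs)"
        using Suc.prems by (intro Suc.IH) auto
      then show ?case
        by (rule AE_iter_mono) (use elim in auto)
    qed
  qed simp
  from this[of "{}"] show ?thesis by simp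
qed

section \<open>Limits of approximate colorings\<close>

text \<open>The colorings \<open>g n\<close> need not converge. A finite tuple has finitely many
  pairs, so almost surely a single large \<open>n\<close> separates all its pairs with
  \<open>W \<noteq> 0\<close>, and \<open>g n\<close> colors the tuple.\<close>

lemma graphon_coloring_of_eventually:
  fixes g :: "nat \<Rightarrow> 'a \<Rightarrow> nat"
  assumes W: "W \<in> borel_measurable (M \<Otimes>\<^sub>M M)"
    and range: "\<And>n x. x \<in> space M \<Longrightarrow> g n x \<in> {1..m}"
    and ev: "AE z in M \<Otimes>\<^sub>M M. W z \<noteq> 0 \<longrightarrow> (\<forall>\<^sub>F n in sequentially. g n (fst z) \<noteq> g n (snd z))"
  shows "\<exists>f. graphon_coloring M W m f"
proof (rule graphon_coloring_of_finite[OF W])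
  fix k
  interpret MM: pair_sigma_finite M M ..
  define R where "R n x y \<longleftrightarrow> (g n x = g n y \<longrightarrow> W (x, y) = 0)" for n x y
  have "AE x in M. AE y in M. \<forall>\<^sub>F n in sequentially. R n x y"
    using MM.AE_pair[OF ev]
  proof (elim eventually_mono)
    fix x y
    assume "W (x, y) \<noteq> 0 \<longrightarrow> (\<forall>\<^sub>F n in sequentially. g n (fst (x, y)) \<noteq> g n (snd (x, y)))"
    then show "\<forall>\<^sub>F n in sequentially. R n x y"
      by (cases "W (x, y) = 0") (auto simp: R_def elim: eventually_mono)
  qed
  then have "AE_iter M k (\<lambda>xs. (\<forall>x\<in>set xs. x \<in> space M) \<and>
      sorted_wrt (\<lambda>x y. \<forall>\<^sub>F n in sequentially. R n x y) xs)"
    by (intro AE_iter_sorted_wrt) auto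
  then show "AE_iter M k (extendable W m [])"
  proof (rule AE_iter_mono)
    fix xs
    assume xs: "(\<forall>x\<in>set xs. x \<in> space M) \<and> sorted_wrt (\<lambda>x y. \<forall>\<^sub>F n in sequentially. R n x y) xs"
    then have "sorted_wrt (\<lambda>x y. \<forall>\<^sub>F n in sequentially. R n x y) xs" ..
    then have "\<forall>\<^sub>F n in sequentially. sorted_wrt (R n) xs"
      by (induction xs) (auto intro!: eventually_conj eventually_ball_finite)
    then obtain n where n: "sorted_wrt (R n) xs"
      using eventually_happens' sequentially_bot by blast
    have "zip xs (map (g n) xs) = map (\<lambda>x. (x, g n x)) xs"
      by (induction xs) auto
    moreover have "set (map (g n) xs) \<subseteq> {1..m}"
      using range xs by auto
    ultimately show "extendable W m [] xs"
      using n unfolding extendable_def proper_list_def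
      by (intro exI[of _ "map (g n) xs"]) (simp add: sorted_wrt_map R_def[abs_def])
  qed
qed

lemma measurable_same_color:
  fixes g :: "'a \<Rightarrow> nat"
  assumes [measurable]: "g \<in> measurable M (count_space UNIV)"
  shows "Measurable.pred (M \<Otimes>\<^sub>M M) (\<lambda>z. g (fst z) = g (snd z))"
proof -
  have "Measurable.pred (M \<Otimes>\<^sub>M M) (\<lambda>z. \<exists>i. g (fst z) = i \<and> g (snd z) = i)"
    by measurable
  then show ?thesis by (simp add: eq_commute)
qed

text \<open>Borel--Cantelli in integral form: with errors \<open>(1/2) ^ n\<close> the sum of the
  \<open>h n\<close> has finite integral, so \<open>h n z\<close> tends to 0 almost everywhere. As
  \<open>h n z\<close> is \<open>W z\<close> or 0, it is eventually 0 where
  \<open>W z \<noteq> 0\<close>, so the colors differ.\<close>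

lemma graphon_coloring_of_approx:
  assumes W[measurable]: "W \<in> borel_measurable (M \<Otimes>\<^sub>M M)"
    and W_nonneg: "\<And>x y. x \<in> space M \<Longrightarrow> y \<in> space M \<Longrightarrow> 0 \<le> W (x, y)"
    and approx: "\<And>\<epsilon>::real. \<epsilon> > 0 \<Longrightarrow> \<exists>g \<in> measurable M (count_space UNIV). g ` space M \<subseteq> {1..m} \<and>
        (\<integral>\<^sup>+z. ennreal (if g (fst z) = g (snd z) then W z else 0) \<partial>(M \<Otimes>\<^sub>M M)) \<le> ennreal \<epsilon>"
  shows "\<exists>f. graphon_coloring M W m f"
proof -
  have "\<forall>n. \<exists>g. g \<in> measurable M (count_space UNIV) \<and> g ` space M \<subseteq> {1..m} \<and>
      (\<integral>\<^sup>+z. ennreal (if g (fst z) = g (snd z) then W z else 0) \<partial>(M \<Otimes>\<^sub>M M)) \<le> ennreal ((1/2) ^ n)"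
  proof
    fix n
    show "\<exists>g. g \<in> measurable M (count_space UNIV) \<and> g ` space M \<subseteq> {1..m} \<and>
      (\<integral>\<^sup>+z. ennreal (if g (fst z) = g (snd z) then W z else 0) \<partial>(M \<Otimes>\<^sub>M M)) \<le> ennreal ((1/2) ^ n)"
      using approx[of "(1/2) ^ n"] by auto
  qed
  from choice[OF this] obtain g :: "nat \<Rightarrow> 'a \<Rightarrow> nat" where g[measurable]: "\<And>n. g n \<in> measurable M (count_space UNIV)"
      and g_range: "\<And>n. g n ` space M \<subseteq> {1..m}"
      and g_int: "\<And>n. (\<integral>\<^sup>+z. ennreal (if g n (fst z) = g n (snd z) then W z else 0) \<partial>(M \<Otimes>\<^sub>M M))
                       \<le> ennreal ((1/2) ^ n)"
    by blast
  define h where "h n z = (if g n (fst z) = g n (snd z) then W z else 0)" for n z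
  note [measurable] = measurable_same_color
  have [measurable]: "h n \<in> borel_measurable (M \<Otimes>\<^sub>M M)" for n
    unfolding h_def by measurable
  have "(\<integral>\<^sup>+z. (\<Sum>n. ennreal (h n z)) \<partial>(M \<Otimes>\<^sub>M M)) = (\<Sum>n. \<integral>\<^sup>+z. ennreal (h n z) \<partial>(M \<Otimes>\<^sub>M M))"
    by (rule nn_integral_suminf) measurable
  also have "\<dots> \<le> (\<Sum>n. ennreal ((1/2) ^ n))"
    using g_int unfolding h_def by (intro suminf_le) auto
  also have "\<dots> = ennreal (\<Sum>n. (1/2) ^ n)"
    by (rule suminf_ennreal2) auto
  also have "\<dots> < \<infinity>" by simp
  finally have "AE z in M \<Otimes>\<^sub>M M. (\<Sum>n. ennreal (h n z)) \<noteq> \<infinity>"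
    by (intro nn_integral_PInf_AE) auto
  then have "AE z in M \<Otimes>\<^sub>M M. W z \<noteq> 0 \<longrightarrow> (\<forall>\<^sub>F n in sequentially. g n (fst z) \<noteq> g n (snd z))"
    using AE_space
  proof eventually_elim
    case (elim z)
    have W_z: "0 \<le> W z"
      using W_nonneg elim(2) by (auto simp: space_pair_measure)
    then have "summable (\<lambda>n. h n z)"
      using elim(1) by (intro summable_suminf_not_top) (auto simp: h_def)
    then have "(\<lambda>n. h n z) \<longlonglongrightarrow> 0"
      by (rule summable_LIMSEQ_zero)
    then have "\<forall>\<^sub>F n in sequentially. h n z < W z" if "W z \<noteq> 0"
      using that W_z by (intro order_tendstoD) auto
    then show ?case
      by (auto elim!: eventually_mono simp: h_def)
  qed
  then show ?thesis
    using g_range by (intro graphon_coloring_of_eventually[OF W, of g]) blast+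
qed

text \<open>A supremum of reals is known to bound its members only when they are bounded above; here
  \<open>b\<close> bounds them because the product measure has total mass 1.\<close>

lemma abs_set_integral_le_cut_norm:
  assumes F[measurable]: "F \<in> borel_measurable (M \<Otimes>\<^sub>M M)"
    and bound: "\<And>z. z \<in> space (M \<Otimes>\<^sub>M M) \<Longrightarrow> \<bar>F z\<bar> \<le> b"
    and "A \<in> sets M" "B \<in> sets M"
  shows "\<bar>set_lebesgue_integral (M \<Otimes>\<^sub>M M) (A \<times> B) F\<bar> \<le> cut_norm M F"
proof -
  interpret MM: pair_prob_space M M ..
  let ?I = "\<lambda>(A, B). \<bar>set_lebesgue_integral (M \<Otimes>\<^sub>M M) (A \<times> B) F\<bar>"
  have "?I AB \<le> b" if in_sets: "AB \<in> sets M \<times> sets M" for AB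
  proof -
    obtain A B where AB: "AB = (A, B)" and [measurable]: "A \<in> sets M" "B \<in> sets M"
      using in_sets by auto
    let ?f = "\<lambda>z. indicat_real (A \<times> B) z *\<^sub>R F z"
    have f_bound: "\<bar>?f z\<bar> \<le> b" if "z \<in> space (M \<Otimes>\<^sub>M M)" for z
      using bound[OF that] by (auto simp: indicator_def)
    then have "integrable (M \<Otimes>\<^sub>M M) ?f"
      by (intro MM.P.integrable_const_bound[where B = b] AE_I2) auto
    then have "(\<integral>z. \<bar>?f z\<bar> \<partial>(M \<Otimes>\<^sub>M M)) \<le> b"
      using f_bound by (intro MM.P.integral_le_const AE_I2) auto
    moreover have "?I AB \<le> (\<integral>z. \<bar>?f z\<bar> \<partial>(M \<Otimes>\<^sub>M M))"
      unfolding AB set_lebesgue_integral_def by (auto intro: integral_abs_bound)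
    ultimately show ?thesis by linarith
  qed
  then have "bdd_above (?I ` (sets M \<times> sets M))"
    by (auto intro!: bdd_aboveI2)
  then have "?I (A, B) \<le> (SUP AB\<in>sets M \<times> sets M. ?I AB)"
    using assms by (intro cSUP_upper) auto
  then show ?thesis
    by (simp add: cut_norm_def)
qed

end

section \<open>Cut-distance limits\<close>

context prob_space
begin

text \<open>The identity is an automorphism, so the infimum is over a nonempty set and some member
  falls below \<open>\<epsilon>\<close>.\<close>

lemma cut_dist_lessE:
  assumes "cut_dist M U W < \<epsilon>"
  obtains \<phi> where "\<phi> \<in> automorphisms M"
    "cut_norm M (\<lambda>(x, y). U (x, y) - W (\<phi> x, \<phi> y)) < \<epsilon>"
proof -
  have "inv_into (space M) (\<lambda>x. x) x = x" if "x \<in> space M" for x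
    using that by (intro inv_into_f_eq) auto
  then have "inv_into (space M) (\<lambda>x. x) \<in> measurable M M"
    by (simp cong: measurable_cong)
  then have "(\<lambda>x. x) \<in> automorphisms M"
    by (auto simp: automorphisms_def bij_betw_def distr_id2)
  then have "\<exists>v \<in> (\<lambda>\<phi>. cut_norm M (\<lambda>(x, y). U (x, y) - W (\<phi> x, \<phi> y))) ` automorphisms M. v < \<epsilon>"
    using assms unfolding cut_dist_def by (intro cInf_lessD) auto
  then show thesis
    using that by auto
qed

text \<open>A color class of the graph spans no edges, so on its square the difference of
  \<open>U\<close> and the rearranged \<open>W\<close> is the negative of the latter, and the cut
  norm bounds the mass there. Summing over \<open>m\<close> classes gives
  \<open>real m * \<epsilon>\<close>.\<close>

lemma almost_coloring_of_close_graph: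
  assumes W: "graphon M W" and G: "pair_graph H" and c: "graph_coloring H m c"
    and U: "graphon_rep M H U" and close: "cut_dist M U W < \<epsilon>"
  shows "\<exists>g \<in> measurable M (count_space UNIV). g ` space M \<subseteq> {1..m} \<and>
        (\<integral>\<^sup>+z. ennreal (if g (fst z) = g (snd z) then W z else 0) \<partial>(M \<Otimes>\<^sub>M M)) \<le> ennreal (real m * \<epsilon>)"
proof -
  interpret H: pair_graph H by fact
  interpret MM: pair_prob_space M M ..
  obtain p where p: "p \<in> measurable M (count_space (pverts H))"
      and U_eq: "U = (\<lambda>(x, y). if (p x, p y) \<in> parcs H then 1 else 0)"
    using U unfolding graphon_rep_def by blast
  obtain \<phi> where \<phi>: "\<phi> \<in> automorphisms M"
      and cut: "cut_norm M (\<lambda>(x, y). U (x, y) - W (\<phi> x, \<phi> y)) < \<epsilon>"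
    using cut_dist_lessE[OF close] by blast
  \<comment> \<open>\<open>\<phi>\<close> rearranges \<open>W\<close>, not the graph; its inverse
    carries the coloring of the graph back to \<open>W\<close>.\<close>
  define \<psi> where "\<psi> = inv_into (space M) \<phi>"
  have \<phi>_meas[measurable]: "\<phi> \<in> measurable M M" and \<phi>_bij: "bij_betw \<phi> (space M) (space M)"
      and \<psi>_meas[measurable]: "\<psi> \<in> measurable M M" and \<phi>_distr: "distr M M \<phi> = M"
    using \<phi> by (auto simp: automorphisms_def \<psi>_def)
  have \<psi>\<phi>: "\<psi> (\<phi> x) = x" if "x \<in> space M" for x
    using \<phi>_bij that by (auto simp: \<psi>_def bij_betw_def)
  have W_meas[measurable]: "W \<in> borel_measurable (M \<Otimes>\<^sub>M M)"
    using W by (simp add: graphon_def)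
  have W_range: "0 \<le> W (x, y)" "W (x, y) \<le> 1" if "x \<in> space M" "y \<in> space M" for x y
    using W that by (auto simp: graphon_def)
  define g0 where "g0 x = c (p x)" for x
  have g0_meas[measurable]: "g0 \<in> measurable M (count_space UNIV)"
    unfolding g0_def by (rule measurable_compose[OF p]) simp
  have g0_range: "g0 x \<in> {1..m}" if "x \<in> space M" for x
    using c measurable_space[OF p that] by (auto simp: g0_def graph_coloring_def)
  have U_0: "U (x, y) = 0" if "g0 x = g0 y" for x y
    using c that by (auto simp: U_eq g0_def graph_coloring_def)
  have [measurable]: "U \<in> borel_measurable (M \<Otimes>\<^sub>M M)"
  proof -
    have "(\<lambda>z. (p (fst z), p (snd z))) \<in> measurable (M \<Otimes>\<^sub>M M) (count_space (pverts H) \<Otimes>\<^sub>M count_space (pverts H))"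
      using p by measurable
    also have "count_space (pverts H) \<Otimes>\<^sub>M count_space (pverts H) = count_space (pverts H \<times> pverts H)"
      by (intro pair_measure_countable countable_finite) simp_all
    finally have "(\<lambda>z. (p (fst z), p (snd z))) \<in> measurable (M \<Otimes>\<^sub>M M) (count_space (pverts H \<times> pverts H))" .
    from measurable_compose[OF this, of "\<lambda>e. if e \<in> parcs H then 1 else 0 :: real" borel] show ?thesis
      by (simp add: U_eq case_prod_beta')
  qed
  define A where "A i = g0 -` {i} \<inter> space M" for i
  have [measurable]: "A i \<in> sets M" for i
    unfolding A_def by measurable
  define V where "V z = W (\<phi> (fst z), \<phi> (snd z))" for z
  have [measurable]: "V \<in> borel_measurable (M \<Otimes>\<^sub>M M)"
    unfolding V_def by measurable
  have V_range: "0 \<le> V z" "V z \<le> 1" if "z \<in> space (M \<Otimes>\<^sub>M M)" for z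
    using that measurable_space[OF \<phi>_meas] W_range by (auto simp: V_def space_pair_measure)
  have int: "integrable (M \<Otimes>\<^sub>M M) (\<lambda>z. indicat_real (A i \<times> A i) z * V z)" for i
    using V_range by (intro MM.P.integrable_const_bound[where B = 1] AE_I2) (auto simp: indicator_def)
  have le_\<epsilon>: "(\<integral>z. indicat_real (A i \<times> A i) z * V z \<partial>(M \<Otimes>\<^sub>M M)) \<le> \<epsilon>" for i
  proof -
    let ?F = "\<lambda>(x, y). U (x, y) - W (\<phi> x, \<phi> y)"
    have F: "?F = (\<lambda>z. U z - V z)"
      by (auto simp: V_def)
    have "\<bar>set_lebesgue_integral (M \<Otimes>\<^sub>M M) (A i \<times> A i) ?F\<bar> \<le> cut_norm M ?F"
      unfolding F
    proof (rule abs_set_integral_le_cut_norm)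
      fix z
      assume "z \<in> space (M \<Otimes>\<^sub>M M)"
      moreover have "0 \<le> U z" "U z \<le> 1"
        by (auto simp: U_eq split: prod.split)
      ultimately show "\<bar>U z - V z\<bar> \<le> 1"
        using V_range[of z] by linarith
    qed measurable
    moreover have "set_lebesgue_integral (M \<Otimes>\<^sub>M M) (A i \<times> A i) ?F =
        (\<integral>z. - (indicat_real (A i \<times> A i) z * V z) \<partial>(M \<Otimes>\<^sub>M M))"
      unfolding set_lebesgue_integral_def F
      by (intro Bochner_Integration.integral_cong) (auto simp: indicator_def A_def U_0)
    ultimately show ?thesis
      using cut by simp
  qed
  define g where "g = g0 \<circ> \<psi>"
  have g_meas[measurable]: "g \<in> measurable M (count_space UNIV)"
    unfolding g_def by measurable
  note [measurable] = measurable_same_color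
  \<comment> \<open>Substituting \<open>\<phi>\<close>, which preserves \<open>M\<close>, in the
    integral of \<open>?h\<close> replaces \<open>g\<close> by \<open>g0\<close> and
    \<open>W\<close> by \<open>V\<close>.\<close>
  let ?h = "\<lambda>z. ennreal (if g (fst z) = g (snd z) then W z else 0)"
  have "integral\<^sup>N (M \<Otimes>\<^sub>M M) ?h = integral\<^sup>N (distr M M \<phi> \<Otimes>\<^sub>M distr M M \<phi>) ?h"
    by (simp add: \<phi>_distr)
  also have "distr M M \<phi> \<Otimes>\<^sub>M distr M M \<phi> = distr (M \<Otimes>\<^sub>M M) (M \<Otimes>\<^sub>M M) (\<lambda>z. (\<phi> (fst z), \<phi> (snd z)))"
    by (subst pair_measure_distr) (simp_all add: \<phi>_distr sigma_finite_measure_axioms case_prod_beta')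
  also have "integral\<^sup>N \<dots> ?h = (\<integral>\<^sup>+z. ?h (\<phi> (fst z), \<phi> (snd z)) \<partial>(M \<Otimes>\<^sub>M M))"
    by (subst nn_integral_distr) simp_all
  \<comment> \<open>The colors agree exactly when both points lie in one class \<open>A i\<close>,
    and only \<open>i = g0 (fst z)\<close> is possible.\<close>
  also have "\<dots> = (\<integral>\<^sup>+z. ennreal (\<Sum>i\<in>{1..m}. indicat_real (A i \<times> A i) z * V z) \<partial>(M \<Otimes>\<^sub>M M))"
  proof (intro nn_integral_cong arg_cong[where f = ennreal])
    fix z
    assume "z \<in> space (M \<Otimes>\<^sub>M M)"
    then have z: "fst z \<in> space M" "snd z \<in> space M"
      by (auto simp: space_pair_measure)
    have "indicat_real (A i \<times> A i) z * V z =
        (if i = g0 (fst z) then if g0 (fst z) = g0 (snd z) then V z else 0 else 0)" for i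
      using z by (cases z) (auto simp: A_def indicator_def)
    then have "(\<Sum>i\<in>{1..m}. indicat_real (A i \<times> A i) z * V z) = (if g0 (fst z) = g0 (snd z) then V z else 0)"
      using g0_range[OF z(1)] by simp
    then show "(if g (fst (\<phi> (fst z), \<phi> (snd z))) = g (snd (\<phi> (fst z), \<phi> (snd z)))
        then W (\<phi> (fst z), \<phi> (snd z)) else 0) = (\<Sum>i\<in>{1..m}. indicat_real (A i \<times> A i) z * V z)"
      using z by (simp add: g_def \<psi>\<phi> V_def)
  qed
  also have "\<dots> = ennreal (\<integral>z. (\<Sum>i\<in>{1..m}. indicat_real (A i \<times> A i) z * V z) \<partial>(M \<Otimes>\<^sub>M M))"
    using int V_range by (intro nn_integral_eq_integral Bochner_Integration.integrable_sum AE_I2 sum_nonneg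
        mult_nonneg_nonneg) simp_all
  also have "\<dots> = ennreal (\<Sum>i\<in>{1..m}. \<integral>z. indicat_real (A i \<times> A i) z * V z \<partial>(M \<Otimes>\<^sub>M M))"
    by (intro arg_cong[where f = ennreal] Bochner_Integration.integral_sum int)
  also have "\<dots> \<le> ennreal (real m * \<epsilon>)"
    using sum_mono[of "{1..m}", OF le_\<epsilon>] by (intro ennreal_leI) simp
  finally have "integral\<^sup>N (M \<Otimes>\<^sub>M M) ?h \<le> ennreal (real m * \<epsilon>)" .
  moreover have "g ` space M \<subseteq> {1..m}"
    using g0_range measurable_space[OF \<psi>_meas] unfolding g_def comp_def by blast
  ultimately show ?thesis
    using g_meas by blast
qed

text \<open>If \<open>enat m\<close> were below the chromatic number of \<open>W\<close> but
  infinitely many graphs had \<open>m\<close>-colorings, some of those graphs would be arbitrarily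
  close to \<open>W\<close>, and their colorings would yield one of \<open>W\<close>.\<close>

lemma graphon_chi_le_liminf:
  assumes W: "graphon M W" and G: "\<And>n. pair_graph (H n)" and conv: "graphs_converge_cut M H W"
  shows "graphon_chi M W \<le> liminf (\<lambda>n. graph_chi (H n))"
  unfolding le_Liminf_iff
proof safe
  fix y
  assume y: "y < graphon_chi M W"
  then obtain m where m: "y = enat m"
    by (cases y) auto
  obtain U where U: "\<And>n. graphon_rep M (H n) (U n)" and lim: "(\<lambda>n. cut_dist M (U n) W) \<longlonglongrightarrow> 0"
    using conv by (auto simp: graphs_converge_cut_def)
  show "\<forall>\<^sub>F n in sequentially. y < graph_chi (H n)"
  proof (rule ccontr)
    assume "\<not> ?thesis"
    then have freq: "\<exists>\<^sub>F n in sequentially. graph_chi (H n) \<le> enat m"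
      by (simp add: not_eventually m not_less)
    have "\<exists>f. graphon_coloring M W m f"
    proof (rule graphon_coloring_of_approx)
      fix \<epsilon> :: real
      assume \<epsilon>: "\<epsilon> > 0"
      \<comment> \<open>The denominator \<open>m + 1\<close> is positive also for
        \<open>m = 0\<close>.\<close>
      then have "\<forall>\<^sub>F n in sequentially. cut_dist M (U n) W < \<epsilon> / (real m + 1)"
        by (intro order_tendstoD(2)[OF lim]) simp
      from frequently_eventually_frequently[OF freq this]
      obtain n where n: "graph_chi (H n) \<le> enat m" "cut_dist M (U n) W < \<epsilon> / (real m + 1)"
        using frequently_ex by blast
      obtain c where "graph_coloring (H n) m c"
        using n(1) by (auto simp: graph_chi_le_iff)
      from almost_coloring_of_close_graph[OF W G this U n(2)]
      obtain g where g: "g \<in> measurable M (count_space UNIV)" "g ` space M \<subseteq> {1..m}"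
          "(\<integral>\<^sup>+z. ennreal (if g (fst z) = g (snd z) then W z else 0) \<partial>(M \<Otimes>\<^sub>M M))
            \<le> ennreal (real m * (\<epsilon> / (real m + 1)))"
        by blast
      have "real m * (\<epsilon> / (real m + 1)) \<le> \<epsilon>"
        using \<epsilon> by (simp add: field_simps)
      with g(3) have "(\<integral>\<^sup>+z. ennreal (if g (fst z) = g (snd z) then W z else 0) \<partial>(M \<Otimes>\<^sub>M M)) \<le> ennreal \<epsilon>"
        using ennreal_leI order_trans by blast
      with g show "\<exists>g \<in> measurable M (count_space UNIV). g ` space M \<subseteq> {1..m} \<and>
          (\<integral>\<^sup>+z. ennreal (if g (fst z) = g (snd z) then W z else 0) \<partial>(M \<Otimes>\<^sub>M M)) \<le> ennreal \<epsilon>"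
        by blast
    qed (use W in \<open>auto simp: graphon_def\<close>)
    then have "graphon_chi M W \<le> enat m"
      by (simp add: graphon_chi_le_iff)
    with y m show False by simp
  qed
qed

end

section \<open>Random edges on a finite vertex set\<close>

text \<open>Arbitrary vertex sets replace \<open>{1..n}\<close> so that disjoint blocks of vertices
  can be treated.\<close>

definition pairs_on :: "nat set \<Rightarrow> (nat \<times> nat) set" where
  "pairs_on J = {(i, j). i \<in> J \<and> j \<in> J \<and> i < j}"

lemma vertex_pairs_eq: "vertex_pairs n = pairs_on {1..n}"
  by (auto simp: vertex_pairs_def pairs_on_def)

lemma pairs_on_subset: "pairs_on J \<subseteq> J \<times> J"
  by (auto simp: pairs_on_def)

lemma finite_pairs_on: "finite J \<Longrightarrow> finite (pairs_on J)"
  by (rule finite_subset[OF pairs_on_subset]) simp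

definition colorable_on :: "nat \<Rightarrow> nat set \<Rightarrow> (nat \<times> nat \<Rightarrow> bool) \<Rightarrow> bool" where
  "colorable_on m J e \<longleftrightarrow> (\<exists>c. c ` J \<subseteq> {1..m} \<and> (\<forall>(i, j)\<in>pairs_on J. e (i, j) \<longrightarrow> c i \<noteq> c j))"

lemma colorable_on_cong:
  assumes "\<And>ij. ij \<in> pairs_on J \<Longrightarrow> e ij = e' ij"
  shows "colorable_on m J e \<longleftrightarrow> colorable_on m J e'"
  using assms unfolding colorable_on_def by (intro ex_cong1 conj_cong refl ball_cong) auto

lemma colorable_on_mono: "colorable_on m J e \<Longrightarrow> I \<subseteq> J \<Longrightarrow> colorable_on m I e"
  unfolding colorable_on_def pairs_on_def by blast

text \<open>An edge is recorded at its increasing pair only, so the relabeling is taken to preserve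
  the order.\<close>

lemma colorable_on_image:
  assumes mono: "strict_mono_on I h"
  shows "colorable_on m (h ` I) e \<longleftrightarrow> colorable_on m I (e \<circ> map_prod h h)"
proof
  assume "colorable_on m (h ` I) e"
  then obtain c where c: "c ` h ` I \<subseteq> {1..m}"
      "\<And>i j. i \<in> h ` I \<Longrightarrow> j \<in> h ` I \<Longrightarrow> i < j \<Longrightarrow> e (i, j) \<Longrightarrow> c i \<noteq> c j"
    by (auto simp: colorable_on_def pairs_on_def)
  then show "colorable_on m I (e \<circ> map_prod h h)"
    using mono by (auto simp: colorable_on_def pairs_on_def strict_mono_onD intro!: exI[of _ "c \<circ> h"])
next
  assume "colorable_on m I (e \<circ> map_prod h h)"
  then obtain c where c: "c ` I \<subseteq> {1..m}"
      "\<And>i j. i \<in> I \<Longrightarrow> j \<in> I \<Longrightarrow> i < j \<Longrightarrow> e (h i, h j) \<Longrightarrow> c i \<noteq> c j"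
    by (auto simp: colorable_on_def pairs_on_def)
  have inv: "inv_into I h (h i) = i" if "i \<in> I" for i
    using strict_mono_on_imp_inj_on[OF mono] that by simp
  have "(c \<circ> inv_into I h) ` h ` I \<subseteq> {1..m}"
    using c(1) inv by auto
  moreover have "(c \<circ> inv_into I h) i \<noteq> (c \<circ> inv_into I h) j"
    if ij: "(i, j) \<in> pairs_on (h ` I)" and e: "e (i, j)" for i j
  proof -
    obtain i' j' where *: "i' \<in> I" "j' \<in> I" "i = h i'" "j = h j'" "h i' < h j'"
      using ij by (auto simp: pairs_on_def)
    then have "i' < j'"
      using mono by (simp add: strict_mono_on_less)
    with * e c(2)[of i' j'] inv show ?thesis by simp
  qed
  ultimately show "colorable_on m (h ` I) e"
    unfolding colorable_on_def by blast
qed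

lemma graph_coloring_graph_of_indicator:
  "graph_coloring (graph_of_indicator n e) m c \<longleftrightarrow>
     c ` {1..n} \<subseteq> {1..m} \<and> (\<forall>(i, j)\<in>pairs_on {1..n}. e (i, j) \<longrightarrow> c i \<noteq> c j)"
  by (fastforce simp: graph_coloring_def graph_of_indicator_def Let_def vertex_pairs_eq)

lemma graph_chi_graph_of_indicator_le:
  "graph_chi (graph_of_indicator n e) \<le> enat m \<longleftrightarrow> colorable_on m {1..n} e"
  unfolding graph_chi_le_iff graph_coloring_graph_of_indicator colorable_on_def ..

text \<open>Induction on \<open>A\<close>: since \<open>h\<close> is injective on
  \<open>insert a A\<close>, \<open>h a\<close> is a new index, and both sides split off an
  independent coordinate with law \<open>p (h a)\<close>.\<close>

lemma Pi_pmf_reindex: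
  assumes "finite A" "inj_on h A"
  shows "Pi_pmf A d (\<lambda>a. p (h a)) =
    map_pmf (\<lambda>g a. if a \<in> A then g (h a) else d) (Pi_pmf (h ` A) d p)"
  using assms
proof (induction A rule: finite_induct)
  case (insert a A)
  have *: "(\<lambda>x. if x \<in> A then g (h x) else d)(a := y) =
      (\<lambda>x. if x \<in> insert a A then (g(h a := y)) (h x) else d)" for g y
    using insert.prems insert.hyps by (auto simp: fun_eq_iff) (metis image_eqI)
  have "Pi_pmf (insert a A) d (\<lambda>a. p (h a)) =
      map_pmf (\<lambda>(y, f). (\<lambda>x. if x \<in> A then f (h x) else d)(a := y))
        (pair_pmf (p (h a)) (Pi_pmf (h ` A) d p))"
    using insert by (simp add: Pi_pmf_insert pair_map_pmf2 map_pmf_comp case_prod_beta')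
  also have "\<dots> = map_pmf (\<lambda>g x. if x \<in> insert a A then g (h x) else d)
      (map_pmf (\<lambda>(y, f). f(h a := y)) (pair_pmf (p (h a)) (Pi_pmf (h ` A) d p)))"
    unfolding map_pmf_comp * by (intro map_pmf_cong refl) (simp split: prod.split)
  also have "map_pmf (\<lambda>(y, f). f(h a := y)) (pair_pmf (p (h a)) (Pi_pmf (h ` A) d p)) =
      Pi_pmf (h ` insert a A) d p"
    using insert.prems insert.hyps by (simp add: Pi_pmf_insert)
  finally show ?case .
qed simp

text \<open>Restricting both events to the supports makes them countable, and for countable events
  the product rule is available.\<close>

lemma measure_pair_pmf_Times:
  "measure_pmf.prob (pair_pmf p q) (A \<times> B) = measure_pmf.prob p A * measure_pmf.prob q B"
proof -
  have "measure_pmf.prob (pair_pmf p q) (A \<times> B) =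
      measure_pmf.prob (pair_pmf p q) ((A \<inter> set_pmf p) \<times> (B \<inter> set_pmf q))"
    by (subst measure_Int_set_pmf[symmetric]) (simp add: Times_Int_Times)
  also have "\<dots> = measure_pmf.prob p A * measure_pmf.prob q B"
    by (subst measure_pmf_prob_product) (simp_all add: measure_Int_set_pmf)
  finally show ?thesis .
qed

definition edge_pmf ::
    "('a \<times> 'a \<Rightarrow> real) \<Rightarrow> (nat \<times> nat) set \<Rightarrow> (nat \<Rightarrow> 'a) \<Rightarrow> (nat \<times> nat \<Rightarrow> bool) pmf" where
  "edge_pmf W V x = Pi_pmf V False (\<lambda>(i, j). bernoulli_pmf (W (x i, x j)))"

text \<open>The conditional probability of \<open>m\<close>-colorability given the sample points
  \<open>x\<close>.\<close>

definition colorable_prob :: "('a \<times> 'a \<Rightarrow> real) \<Rightarrow> nat \<Rightarrow> nat set \<Rightarrow> (nat \<Rightarrow> 'a) \<Rightarrow> real" where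
  "colorable_prob W m J x = measure_pmf.prob (edge_pmf W (pairs_on J) x) {e. colorable_on m J e}"

lemma edge_pmf_cong:
  assumes "\<And>i. i \<in> J \<Longrightarrow> x i = y i" "V \<subseteq> J \<times> J"
  shows "edge_pmf W V x = edge_pmf W V y"
  unfolding edge_pmf_def using assms by (intro Pi_pmf_cong) auto

lemma colorable_prob_cong: "(\<And>i. i \<in> J \<Longrightarrow> x i = y i) \<Longrightarrow> colorable_prob W m J x = colorable_prob W m J y"
  unfolding colorable_prob_def by (subst edge_pmf_cong[OF _ pairs_on_subset]) auto

lemma colorable_prob_image:
  assumes "finite I" "strict_mono_on I h"
  shows "colorable_prob W m (h ` I) x = colorable_prob W m I (x \<circ> h)"
proof -
  let ?h = "map_prod h h"
  have inj: "inj_on ?h (pairs_on I)"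
    using strict_mono_on_imp_inj_on[OF assms(2)] inj_on_subset[OF map_prod_inj_on pairs_on_subset]
    by blast
  have image: "?h ` pairs_on I = pairs_on (h ` I)"
    using assms(2) by (force simp: pairs_on_def strict_mono_on_less)
  have "edge_pmf W (pairs_on I) (x \<circ> h) =
      map_pmf (\<lambda>g a. if a \<in> pairs_on I then g (?h a) else False) (edge_pmf W (pairs_on (h ` I)) x)"
    unfolding edge_pmf_def
    using Pi_pmf_reindex[OF finite_pairs_on[OF assms(1)] inj, of False "\<lambda>(i, j). bernoulli_pmf (W (x i, x j))"]
    by (simp add: image case_prod_beta')
  moreover have "colorable_on m I (\<lambda>a. if a \<in> pairs_on I then g (?h a) else False) \<longleftrightarrow> colorable_on m (h ` I) g" for g
    unfolding colorable_on_image[OF assms(2)] by (intro colorable_on_cong) simp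
  ultimately show ?thesis
    by (simp add: colorable_prob_def vimage_def)
qed

text \<open>A coloring of the union colors both parts, and the edges inside \<open>J\<close> are
  independent of those inside \<open>K\<close>.\<close>

lemma colorable_prob_Un_le:
  assumes fin: "finite J" "finite K" and disj: "J \<inter> K = {}"
  shows "colorable_prob W m (J \<union> K) x \<le> colorable_prob W m J x * colorable_prob W m K x"
proof -
  let ?V = "pairs_on (J \<union> K)" and ?V1 = "pairs_on J" and ?V2 = "pairs_on K"
  let ?C = "\<lambda>J. {e. colorable_on m J e}"
  \<comment> \<open>\<open>?r\<close> forgets the edges between \<open>J\<close> and
    \<open>K\<close>; \<open>?u\<close> joins the two independent families.\<close>
  let ?r = "\<lambda>e ij. if ij \<in> ?V1 \<union> ?V2 then e ij else False"
  let ?u = "\<lambda>(f, g) ij. if ij \<in> ?V1 then f ij else g ij :: bool"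
  have V: "finite ?V"
    using fin by (simp add: finite_pairs_on)
  have sub: "?V1 \<union> ?V2 \<subseteq> ?V" and disjV: "?V1 \<inter> ?V2 = {}"
    using disj by (auto simp: pairs_on_def)
  have "colorable_on m J (?r e) \<longleftrightarrow> colorable_on m J e" "colorable_on m K (?r e) \<longleftrightarrow> colorable_on m K e" for e
    by (rule colorable_on_cong, simp)+
  then have vimage_r: "?r -` (?C J \<inter> ?C K) = ?C J \<inter> ?C K"
    by auto
  have "colorable_on m J (?u (f, g)) \<longleftrightarrow> colorable_on m J f" "colorable_on m K (?u (f, g)) \<longleftrightarrow> colorable_on m K g" for f g
    using disjV by (auto intro!: colorable_on_cong)
  then have "z \<in> ?u -` (?C J \<inter> ?C K) \<longleftrightarrow> z \<in> ?C J \<times> ?C K" for z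
    by (cases z) (simp only: vimage_eq Int_iff mem_Collect_eq mem_Times_iff fst_conv snd_conv)
  then have vimage_u: "?u -` (?C J \<inter> ?C K) = ?C J \<times> ?C K"
    by (rule set_eqI)
  have "colorable_prob W m (J \<union> K) x \<le> measure_pmf.prob (edge_pmf W ?V x) (?C J \<inter> ?C K)"
    unfolding colorable_prob_def by (intro measure_pmf.finite_measure_mono) (auto intro: colorable_on_mono)
  also have "\<dots> = measure_pmf.prob (map_pmf ?r (edge_pmf W ?V x)) (?C J \<inter> ?C K)"
    by (simp only: measure_map_pmf vimage_r)
  also have "map_pmf ?r (edge_pmf W ?V x) = edge_pmf W (?V1 \<union> ?V2) x"
    unfolding edge_pmf_def using V sub by (intro Pi_pmf_subset[symmetric])
  also have "\<dots> = map_pmf ?u (pair_pmf (edge_pmf W ?V1 x) (edge_pmf W ?V2 x))"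
    unfolding edge_pmf_def using fin disjV by (intro Pi_pmf_union finite_pairs_on)
  also have "measure_pmf.prob \<dots> (?C J \<inter> ?C K) = colorable_prob W m J x * colorable_prob W m K x"
    by (simp only: measure_map_pmf vimage_u measure_pair_pmf_Times colorable_prob_def)
  finally show ?thesis .
qed

section \<open>Random sample points\<close>

lemma edge_pmf_supp_nonzero:
  assumes "finite V" "e \<in> set_pmf (edge_pmf W V x)" "(i, j) \<in> V" "e (i, j)"
  shows "W (x i, x j) \<noteq> 0"
proof
  assume "W (x i, x j) = 0"
  moreover have "e (i, j) \<in> set_pmf (bernoulli_pmf (W (x i, x j)))"
    using assms(1-3) by (auto simp: edge_pmf_def set_Pi_pmf PiE_dflt_def)
  ultimately show False
    using assms(4) by (simp add: set_pmf_iff)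
qed

text \<open>The graph with all edges allowed by \<open>W\<close> has positive probability, so a
  property that the random graph has with probability 1 must hold for it. This turns colorability of
  samples into a statement about \<open>W\<close>.\<close>

lemma full_edge_set_in_supp:
  assumes "finite V" "\<And>i j. (i, j) \<in> V \<Longrightarrow> 0 \<le> W (x i, x j) \<and> W (x i, x j) \<le> 1"
  shows "(\<lambda>(i, j). (i, j) \<in> V \<and> W (x i, x j) \<noteq> 0) \<in> set_pmf (edge_pmf W V x)"
proof -
  have "(W (x i, x j) \<noteq> 0) \<in> set_pmf (bernoulli_pmf (W (x i, x j)))" if "(i, j) \<in> V" for i j
    using assms(2)[OF that] by (cases "W (x i, x j) = 0") (auto simp: set_pmf_iff)
  then show ?thesis
    using assms(1) by (auto simp: edge_pmf_def set_Pi_pmf PiE_dflt_def)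
qed

context prob_space
begin

text \<open>For finite \<open>V\<close> the probability is a finite sum of products of values of
  \<open>W\<close> and \<open>1 - W\<close> at the sample coordinates.\<close>

lemma measurable_edge_pmf_prob:
  assumes W: "graphon M W" and "finite J" "V \<subseteq> J \<times> J"
  shows "(\<lambda>x. measure_pmf.prob (edge_pmf W V x) A) \<in> borel_measurable (PiM J (\<lambda>_. M))"
proof -
  have [measurable]: "W \<in> borel_measurable (M \<Otimes>\<^sub>M M)"
    using W by (simp add: graphon_def)
  have V: "finite V"
    using assms(2,3) by (auto intro: finite_subset)
  \<comment> \<open>The finitely many edge indicators that are \<open>False\<close> outside
    \<open>V\<close>; they carry all the mass.\<close>
  define D where "D = PiE_dflt V False (\<lambda>_. UNIV :: bool set)"
  have D: "finite D"
    unfolding D_def using V by (intro finite_PiE_dflt) auto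
  have "measure_pmf.prob (edge_pmf W V x) A =
      (\<Sum>e\<in>A \<inter> D. \<Prod>ij\<in>V. if e ij then W (x (fst ij), x (snd ij)) else 1 - W (x (fst ij), x (snd ij)))"
    if x: "x \<in> space (PiM J (\<lambda>_. M))" for x
  proof -
    have "0 \<le> W (x i, x j) \<and> W (x i, x j) \<le> 1" if "(i, j) \<in> V" for i j
      using that x W assms(3) by (auto simp: graphon_def space_PiM PiE_iff)
    then have pmf: "pmf (edge_pmf W V x) e =
        (\<Prod>ij\<in>V. if e ij then W (x (fst ij), x (snd ij)) else 1 - W (x (fst ij), x (snd ij)))"
      if "e \<in> D" for e
      using that V unfolding edge_pmf_def
      by (subst pmf_Pi') (auto simp: D_def PiE_dflt_def intro!: prod.cong split: prod.split)
    have "set_pmf (edge_pmf W V x) \<subseteq> D"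
      using set_Pi_pmf_subset[OF V] by (fastforce simp: edge_pmf_def D_def PiE_dflt_def)
    then have "measure_pmf.prob (edge_pmf W V x) A = measure_pmf.prob (edge_pmf W V x) (A \<inter> D)"
      by (metis (no_types, lifting) Int_assoc inf.absorb_iff2 measure_Int_set_pmf)
    also have "\<dots> = (\<Sum>e\<in>A \<inter> D. pmf (edge_pmf W V x) e)"
      using D by (intro measure_measure_pmf_finite) auto
    finally show ?thesis
      using pmf by simp
  qed
  moreover have "(\<lambda>x. \<Sum>e\<in>A \<inter> D. \<Prod>ij\<in>V. if e ij then W (x (fst ij), x (snd ij)) else 1 - W (x (fst ij), x (snd ij)))
      \<in> borel_measurable (PiM J (\<lambda>_. M))"
  proof -
    have [measurable]: "(\<lambda>x. W (x (fst ij), x (snd ij))) \<in> borel_measurable (PiM J (\<lambda>_. M))"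
      if "ij \<in> V" for ij
    proof -
      have [simp]: "fst ij \<in> J" "snd ij \<in> J"
        using that assms(3) by auto
      show ?thesis by measurable
    qed
    show ?thesis
      by (intro borel_measurable_sum borel_measurable_prod) simp
  qed
  ultimately show ?thesis
    by (simp cong: measurable_cong)
qed

lemma measurable_colorable_prob:
  "graphon M W \<Longrightarrow> finite J \<Longrightarrow> colorable_prob W m J \<in> borel_measurable (PiM J (\<lambda>_. M))"
  unfolding colorable_prob_def[abs_def] by (intro measurable_edge_pmf_prob pairs_on_subset)

text \<open>Averaging over the sample gives the unconditional probability;
  \<open>emeasure_W_random_graph\<close> identifies it for \<open>J = {1..n}\<close>.\<close>

definition sample_colorable_prob :: "('a \<times> 'a \<Rightarrow> real) \<Rightarrow> nat \<Rightarrow> nat set \<Rightarrow> ennreal" where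
  "sample_colorable_prob W m J = (\<integral>\<^sup>+x. ennreal (colorable_prob W m J x) \<partial>PiM J (\<lambda>_. M))"

text \<open>Fubini: the samples on the two blocks are independent, and for fixed samples
  \<open>colorable_prob_Un_le\<close> applies.\<close>

lemma sample_colorable_prob_Un_le:
  assumes W: "graphon M W" and fin: "finite J" "finite K" and disj: "J \<inter> K = {}"
  shows "sample_colorable_prob W m (J \<union> K) \<le> sample_colorable_prob W m J * sample_colorable_prob W m K"
proof -
  interpret PS: product_sigma_finite "\<lambda>_. M" ..
  note [measurable] = fin[THEN measurable_colorable_prob[OF W]]
  have "sample_colorable_prob W m (J \<union> K) =
      (\<integral>\<^sup>+x. (\<integral>\<^sup>+y. ennreal (colorable_prob W m (J \<union> K) (merge J K (x, y))) \<partial>PiM K (\<lambda>_. M)) \<partial>PiM J (\<lambda>_. M))"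
    unfolding sample_colorable_prob_def using fin disj
    by (intro PS.product_nn_integral_fold) (auto intro!: measurable_compose[OF measurable_colorable_prob[OF W]])
  also have "\<dots> \<le> (\<integral>\<^sup>+x. (\<integral>\<^sup>+y. ennreal (colorable_prob W m J x) * ennreal (colorable_prob W m K y)
      \<partial>PiM K (\<lambda>_. M)) \<partial>PiM J (\<lambda>_. M))"
  proof (intro nn_integral_mono)
    fix x y :: "nat \<Rightarrow> 'a"
    let ?z = "merge J K (x, y)"
    have "colorable_prob W m (J \<union> K) ?z \<le> colorable_prob W m J ?z * colorable_prob W m K ?z"
      by (rule colorable_prob_Un_le[OF fin disj])
    moreover have "colorable_prob W m J ?z = colorable_prob W m J x" "colorable_prob W m K ?z = colorable_prob W m K y"
      using disj by (auto intro!: colorable_prob_cong simp: merge_def)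
    ultimately show "ennreal (colorable_prob W m (J \<union> K) ?z) \<le>
        ennreal (colorable_prob W m J x) * ennreal (colorable_prob W m K y)"
      by (simp add: ennreal_mult''[symmetric] ennreal_leI colorable_prob_def)
  qed
  also have "\<dots> = sample_colorable_prob W m J * sample_colorable_prob W m K"
    unfolding sample_colorable_prob_def
    by (simp add: nn_integral_cmult nn_integral_multc)
  finally show ?thesis .
qed

text \<open>The sample points are independent and identically distributed, so relabeling the
  vertices in the same order changes nothing.\<close>

lemma sample_colorable_prob_image:
  assumes W: "graphon M W" and fin: "finite I" and mono: "strict_mono_on I h"
  shows "sample_colorable_prob W m (h ` I) = sample_colorable_prob W m I"
proof -
  have distr: "distr (PiM (h ` I) (\<lambda>_. M)) (PiM I (\<lambda>_. M)) (\<lambda>x. \<lambda>i\<in>I. x (h i)) = PiM I (\<lambda>_. M)"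
    by (intro distr_PiM_reindex strict_mono_on_imp_inj_on mono prob_space_axioms) auto
  have "sample_colorable_prob W m I =
      (\<integral>\<^sup>+x. ennreal (colorable_prob W m I (\<lambda>i\<in>I. x (h i))) \<partial>PiM (h ` I) (\<lambda>_. M))"
    unfolding sample_colorable_prob_def
    using measurable_colorable_prob[OF W fin]
    by (subst distr[symmetric], subst nn_integral_distr) (auto intro!: measurable_restrict)
  also have "\<dots> = sample_colorable_prob W m (h ` I)"
    unfolding sample_colorable_prob_def colorable_prob_image[OF fin mono]
    by (intro nn_integral_cong arg_cong[where f = ennreal] colorable_prob_cong) simp
  finally show ?thesis ..
qed

lemma sample_colorable_prob_le_1: "sample_colorable_prob W m J \<le> 1"
proof -
  interpret P: prob_space "PiM J (\<lambda>_. M)"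
    by (intro prob_space_PiM prob_space_axioms)
  have "sample_colorable_prob W m J \<le> (\<integral>\<^sup>+x. 1 \<partial>PiM J (\<lambda>_. M))"
    unfolding sample_colorable_prob_def by (intro nn_integral_mono) (simp add: colorable_prob_def)
  also have "\<dots> = 1"
    by (simp add: P.emeasure_space_1)
  finally show ?thesis .
qed

lemma sample_colorable_prob_eq_1_iff:
  assumes W: "graphon M W" and fin: "finite J"
  shows "sample_colorable_prob W m J = 1 \<longleftrightarrow> (AE x in PiM J (\<lambda>_. M). colorable_prob W m J x = 1)"
proof
  interpret P: prob_space "PiM J (\<lambda>_. M)"
    by (intro prob_space_PiM prob_space_axioms)
  note [measurable] = measurable_colorable_prob[OF W fin]
  have range: "0 \<le> colorable_prob W m J x" "colorable_prob W m J x \<le> 1" for x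
    by (simp_all add: colorable_prob_def)
  \<comment> \<open>The averages of the probability and of its complement add up to 1; if the first
    is 1, the second vanishes.\<close>
  have "sample_colorable_prob W m J + (\<integral>\<^sup>+x. ennreal (1 - colorable_prob W m J x) \<partial>PiM J (\<lambda>_. M)) =
      (\<integral>\<^sup>+x. 1 \<partial>PiM J (\<lambda>_. M))"
    unfolding sample_colorable_prob_def
    by (subst nn_integral_add[symmetric]) (auto simp: range simp flip: ennreal_plus)
  also have "\<dots> = 1"
    by (simp add: P.emeasure_space_1)
  finally have *: "sample_colorable_prob W m J + (\<integral>\<^sup>+x. ennreal (1 - colorable_prob W m J x) \<partial>PiM J (\<lambda>_. M)) = 1" .
  assume "sample_colorable_prob W m J = 1"
  with * have "(\<integral>\<^sup>+x. ennreal (1 - colorable_prob W m J x) \<partial>PiM J (\<lambda>_. M)) = 0"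
    using ennreal_add_left_cancel[of 1 _ 0] by simp
  then have "AE x in PiM J (\<lambda>_. M). ennreal (1 - colorable_prob W m J x) = 0"
    by (subst (asm) nn_integral_0_iff_AE) auto
  then show "AE x in PiM J (\<lambda>_. M). colorable_prob W m J x = 1"
    by (rule eventually_mono) (use range in \<open>auto simp: ennreal_eq_0_iff intro: antisym\<close>)
next
  interpret P: prob_space "PiM J (\<lambda>_. M)"
    by (intro prob_space_PiM prob_space_axioms)
  assume "AE x in PiM J (\<lambda>_. M). colorable_prob W m J x = 1"
  then have "sample_colorable_prob W m J = (\<integral>\<^sup>+x. 1 \<partial>PiM J (\<lambda>_. M))"
    unfolding sample_colorable_prob_def by (intro nn_integral_cong_AE) (auto elim!: eventually_mono)
  then show "sample_colorable_prob W m J = 1"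
    by (simp add: P.emeasure_space_1)
qed

text \<open>Fubini, peeling off the first coordinate. The offset \<open>a\<close> is general because
  the remaining indices start one higher.\<close>

lemma AE_iter_of_AE_PiM:
  assumes "AE x in PiM {a..<a + k} (\<lambda>_. M). P x"
  shows "AE_iter M k (\<lambda>xs. P (\<lambda>i\<in>{a..<a + k}. xs ! (i - a)))"
  using assms
proof (induction k arbitrary: a P)
  case 0
  interpret P: prob_space "PiM {a..<a + 0} (\<lambda>_. M)"
    by (intro prob_space_PiM prob_space_axioms)
  have "AE x in PiM {a..<a + 0} (\<lambda>_. M). P x \<and> x \<in> space (PiM {a..<a + 0} (\<lambda>_. M))"
    using 0 by auto
  then obtain x where "P x" "x \<in> space (PiM {a..<a + 0} (\<lambda>_. M))"
    using eventually_happens'[OF P.ae_filter_bot] by blast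
  then show ?case
    by (simp add: space_PiM)
next
  case (Suc k)
  let ?I = "{Suc a..<Suc a + k}"
  have I: "{a..<a + Suc k} = insert a ?I"
    by auto
  interpret I: prob_space "PiM ?I (\<lambda>_. M)"
    by (intro prob_space_PiM prob_space_axioms)
  interpret MI: pair_sigma_finite M "PiM ?I (\<lambda>_. M)" ..
  have distr: "distr (M \<Otimes>\<^sub>M PiM ?I (\<lambda>_. M)) (PiM (insert a ?I) (\<lambda>_. M)) (\<lambda>(y, x). x(a := y)) =
      PiM (insert a ?I) (\<lambda>_. M)"
    by (intro distr_pair_PiM_eq_PiM prob_space_axioms)
  have "(\<lambda>(y, x). x(a := y)) \<in> measurable (M \<Otimes>\<^sub>M PiM ?I (\<lambda>_. M)) (PiM (insert a ?I) (\<lambda>_. M))"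
    by measurable
  from AE_distrD[OF this, of P]
  have "AE z in M \<Otimes>\<^sub>M PiM ?I (\<lambda>_. M). P ((\<lambda>(y, x). x(a := y)) z)"
    using Suc.prems unfolding distr I by blast
  from MI.AE_pair[OF this] have "AE y in M. AE x in PiM ?I (\<lambda>_. M). P (x(a := y))"
    by simp
  then show ?case
    unfolding AE_iter.simps
  proof (rule eventually_mono)
    fix y
    assume "AE x in PiM ?I (\<lambda>_. M). P (x(a := y))"
    from Suc.IH[OF this]
    have "AE_iter M k (\<lambda>xs. P ((\<lambda>i\<in>?I. xs ! (i - Suc a))(a := y)))" .
    moreover have "(\<lambda>i\<in>?I. xs ! (i - Suc a))(a := y) = (\<lambda>i\<in>{a..<a + Suc k}. (y # xs) ! (i - a))" for xs
      by (auto simp: fun_eq_iff restrict_def nth_Cons' Suc_diff_Suc)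
    ultimately show "AE_iter M k (\<lambda>xs. P (\<lambda>i\<in>{a..<a + Suc k}. (y # xs) ! (i - a)))"
      by simp
  qed
qed

text \<open>Almost every sample has conditional probability 1; the graph of all pairs with
  \<open>W \<noteq> 0\<close> is then colorable, and its coloring is proper for
  \<open>W\<close>.\<close>

lemma AE_iter_extendable:
  assumes W: "graphon M W" and eq_1: "sample_colorable_prob W m {1..k} = 1"
  shows "AE_iter M k (extendable W m [])"
proof -
  let ?I = "{1..<1 + k}"
  have I: "{1..k} = ?I"
    by auto
  have "AE x in PiM ?I (\<lambda>_. M). colorable_prob W m ?I x = 1"
    using eq_1 unfolding I by (subst (asm) sample_colorable_prob_eq_1_iff[OF W finite_atLeastLessThan])
  then have "AE x in PiM ?I (\<lambda>_. M). colorable_prob W m ?I x = 1 \<and> x \<in> space (PiM ?I (\<lambda>_. M))"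
    by auto
  from AE_iter_of_AE_PiM[OF this] show ?thesis
  proof (rule AE_iter_mono)
    fix xs :: "'a list"
    assume len: "length xs = k"
    define x where "x = (\<lambda>i\<in>?I. xs ! (i - 1))"
    assume "colorable_prob W m ?I (\<lambda>i\<in>?I. xs ! (i - 1)) = 1 \<and>
      (\<lambda>i\<in>?I. xs ! (i - 1)) \<in> space (PiM ?I (\<lambda>_. M))"
    then have col: "colorable_prob W m ?I x = 1" and x: "x \<in> space (PiM ?I (\<lambda>_. M))"
      by (simp_all add: x_def)
    have "0 \<le> W (x i, x j) \<and> W (x i, x j) \<le> 1" if "(i, j) \<in> pairs_on ?I" for i j
      using that x W by (auto simp: pairs_on_def graphon_def space_PiM PiE_iff)
    then have "(\<lambda>(i, j). (i, j) \<in> pairs_on ?I \<and> W (x i, x j) \<noteq> 0) \<in> set_pmf (edge_pmf W (pairs_on ?I) x)"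
      by (intro full_edge_set_in_supp finite_pairs_on) auto
    moreover have "\<forall>e\<in>set_pmf (edge_pmf W (pairs_on ?I) x). colorable_on m ?I e"
      using col by (simp add: colorable_prob_def measure_pmf.prob_eq_1 AE_measure_pmf_iff)
    ultimately have "colorable_on m ?I (\<lambda>(i, j). (i, j) \<in> pairs_on ?I \<and> W (x i, x j) \<noteq> 0)"
      by blast
    then obtain c where c_range: "c ` ?I \<subseteq> {1..m}"
        and c: "\<forall>(i, j)\<in>pairs_on ?I. (i, j) \<in> pairs_on ?I \<and> W (x i, x j) \<noteq> 0 \<longrightarrow> c i \<noteq> c j"
      unfolding colorable_on_def prod.case by blast
    \<comment> \<open>Vertices are counted from 1, list positions from 0.\<close>
    define cs where "cs = map c [1..<1 + k]"
    have cs: "length cs = k" "\<And>l. l < k \<Longrightarrow> cs ! l = c (Suc l)"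
      by (auto simp: cs_def simp del: upt_Suc)
    have "proper_list W (zip xs cs)"
      unfolding proper_list_def sorted_wrt_iff_nth_less
    proof (intro allI impI)
      fix i j
      assume ij: "i < j" "j < length (zip xs cs)"
      then have "(Suc i, Suc j) \<in> pairs_on ?I" "x (Suc i) = xs ! i" "x (Suc j) = xs ! j"
        using len by (auto simp: pairs_on_def x_def cs)
      then show "(case zip xs cs ! i of (x, i) \<Rightarrow> \<lambda>(y, j). i = j \<longrightarrow> W (x, y) = 0) (zip xs cs ! j)"
        using bspec[OF c, of "(Suc i, Suc j)"] ij len by (auto simp: cs)
    qed
    moreover have "set cs \<subseteq> {1..m}"
      using c_range by (auto simp: cs_def)
    ultimately show "extendable W m [] xs"
      using len unfolding extendable_def by (intro exI[of _ cs]) (simp add: cs)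
  qed
qed

text \<open>Carries statements that hold almost everywhere on \<open>M \<Otimes>\<^sub>M M\<close>
  to pairs of coordinates of a sample.\<close>

lemma distr_PiM_two_components:
  assumes "i \<in> J" "j \<in> J" "i \<noteq> j"
  shows "distr (PiM J (\<lambda>_. M)) (M \<Otimes>\<^sub>M M) (\<lambda>x. (x i, x j)) = M \<Otimes>\<^sub>M M"
proof (rule pair_measure_eqI[symmetric])
  interpret PP: product_prob_space "\<lambda>_. M" J ..
  fix A B
  assume [measurable]: "A \<in> sets M" "B \<in> sets M"
  have [measurable]: "(\<lambda>x. (x i, x j)) \<in> measurable (PiM J (\<lambda>_. M)) (M \<Otimes>\<^sub>M M)"
    using assms by measurable
  have "emeasure (distr (PiM J (\<lambda>_. M)) (M \<Otimes>\<^sub>M M) (\<lambda>x. (x i, x j))) (A \<times> B) =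
      emeasure (PiM J (\<lambda>_. M)) {x \<in> space (PiM J (\<lambda>_. M)). \<forall>l\<in>{i, j}. x l \<in> (if l = i then A else B)}"
    using assms by (subst emeasure_distr) (auto intro!: arg_cong2[where f = emeasure])
  also have "\<dots> = emeasure M A * emeasure M B"
    using assms by (subst PP.emeasure_PiM_Collect) auto
  finally show "emeasure M A * emeasure M B = emeasure (distr (PiM J (\<lambda>_. M)) (M \<Otimes>\<^sub>M M) (\<lambda>x. (x i, x j))) (A \<times> B)" ..
qed (use sigma_finite_measure_axioms in auto)

text \<open>Vertex \<open>i\<close> gets the color \<open>f (x i)\<close>. Almost surely
  \<open>W\<close> vanishes at any two sample points of equal color, so the random graph has no edge
  between them.\<close>

lemma sample_colorable_prob_eq_1:
  assumes W: "graphon M W" and f: "graphon_coloring M W m f" and fin: "finite J"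
  shows "sample_colorable_prob W m J = 1"
  unfolding sample_colorable_prob_eq_1_iff[OF W fin]
proof -
  have f_range: "f x \<in> {1..m}" if "x \<in> space M" for x
    using f measurable_space[of f M "count_space {1..m}", OF _ that] by (simp add: graphon_coloring_def)
  have "AE z in M \<Otimes>\<^sub>M M. \<forall>i\<in>{1..m}. z \<in> (f -` {i} \<inter> space M) \<times> (f -` {i} \<inter> space M) \<longrightarrow> W z = 0"
    using f by (intro AE_finite_allI) (auto simp: graphon_coloring_def independent_in_def)
  then have ae: "AE z in M \<Otimes>\<^sub>M M. f (fst z) = f (snd z) \<longrightarrow> W z = 0"
    using AE_space
  proof eventually_elim
    case (elim z)
    then show ?case
      using f_range[of "fst z"] by (cases z) (auto simp: space_pair_measure)
  qed
  have "AE x in PiM J (\<lambda>_. M). f (x (fst ij)) = f (x (snd ij)) \<longrightarrow> W (x (fst ij), x (snd ij)) = 0"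
    if "ij \<in> pairs_on J" for ij
  proof -
    have ij: "fst ij \<in> J" "snd ij \<in> J" "fst ij \<noteq> snd ij"
      using that by (auto simp: pairs_on_def)
    then have "(\<lambda>x. (x (fst ij), x (snd ij))) \<in> measurable (PiM J (\<lambda>_. M)) (M \<Otimes>\<^sub>M M)"
      by measurable
    from AE_distrD[OF this, of "\<lambda>z. f (fst z) = f (snd z) \<longrightarrow> W z = 0"]
    show ?thesis
      using ae unfolding distr_PiM_two_components[OF ij] by simp
  qed
  then have "AE x in PiM J (\<lambda>_. M). \<forall>ij\<in>pairs_on J. f (x (fst ij)) = f (x (snd ij)) \<longrightarrow> W (x (fst ij), x (snd ij)) = 0"
    by (intro AE_finite_allI finite_pairs_on fin)
  then show "AE x in PiM J (\<lambda>_. M). colorable_prob W m J x = 1"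
    using AE_space
  proof eventually_elim
    case (elim x)
    have "colorable_on m J e" if e: "e \<in> set_pmf (edge_pmf W (pairs_on J) x)" for e
      unfolding colorable_on_def
    proof (intro exI[of _ "f \<circ> x"] conjI ballI)
      show "(f \<circ> x) ` J \<subseteq> {1..m}"
        using elim(2) f_range by (auto simp: space_PiM PiE_iff)
      fix ij
      assume "ij \<in> pairs_on J"
      then show "case ij of (i, j) \<Rightarrow> e (i, j) \<longrightarrow> (f \<circ> x) i \<noteq> (f \<circ> x) j"
        using elim(1) edge_pmf_supp_nonzero[OF finite_pairs_on[OF fin] e] by (cases ij) auto
    qed
    then show ?case
      by (simp add: colorable_prob_def measure_pmf.prob_eq_1 AE_measure_pmf_iff)
  qed
qed

lemma emeasure_W_random_graph:
  assumes W: "graphon M W"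
  shows "emeasure (W_random_graph M W n) {G. graph_chi G \<le> enat m} = sample_colorable_prob W m {1..n}"
proof -
  interpret P: prob_space "PiM {1..n} (\<lambda>_. M)"
    by (intro prob_space_PiM prob_space_axioms)
  let ?K = "\<lambda>x. measure_pmf (map_pmf (graph_of_indicator n) (edge_pmf W (pairs_on {1..n}) x))"
  have emeasure_K: "emeasure (?K x) A =
      ennreal (measure_pmf.prob (edge_pmf W (pairs_on {1..n}) x) (graph_of_indicator n -` A))" for x A
    by (simp add: measure_pmf.emeasure_eq_measure)
  \<comment> \<open>Measurability of the kernel lets the measure of the mixture be written as an
    integral.\<close>
  have K: "?K \<in> measurable (PiM {1..n} (\<lambda>_. M)) (subprob_algebra (count_space UNIV))"
  proof (rule measurable_subprob_algebra)
    fix A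
    show "(\<lambda>x. emeasure (?K x) A) \<in> borel_measurable (PiM {1..n} (\<lambda>_. M))"
      unfolding emeasure_K
      using measurable_edge_pmf_prob[OF W _ pairs_on_subset] by simp
  qed (auto intro: prob_space_imp_subprob_space measure_pmf.prob_space_axioms)
  have "W_random_graph M W n = PiM {1..n} (\<lambda>_. M) \<bind> ?K"
    by (simp add: W_random_graph_def edge_pmf_def vertex_pairs_eq)
  then have "emeasure (W_random_graph M W n) {G. graph_chi G \<le> enat m} =
      (\<integral>\<^sup>+x. emeasure (?K x) {G. graph_chi G \<le> enat m} \<partial>PiM {1..n} (\<lambda>_. M))"
    using P.not_empty K by (simp add: emeasure_bind)
  also have "\<dots> = sample_colorable_prob W m {1..n}"
    unfolding emeasure_K sample_colorable_prob_def colorable_prob_def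
    by (simp add: vimage_def graph_chi_graph_of_indicator_le)
  finally show ?thesis .
qed

end

section \<open>Exponential decay and almost sure convergence\<close>

text \<open>Shifting a partial sum \<open>S\<close> by \<open>k\<close> gives
  \<open>S \<le> k + r * S\<close>, which bounds \<open>S\<close> by
  \<open>k / (1 - r)\<close>.\<close>

lemma summable_of_block_decay:
  fixes a :: "nat \<Rightarrow> real"
  assumes nonneg: "\<And>n. 0 \<le> a n" and le_1: "\<And>n. a n \<le> 1"
    and decay: "\<And>n. a (n + k) \<le> r * a n" and r: "0 \<le> r" "r < 1"
  shows "summable a"
proof (rule summableI_nonneg_bounded)
  fix N
  have "(\<Sum>n<N. a n) \<le> (\<Sum>n<N + k. a n)"
    using nonneg by (intro sum_mono2) auto
  also have "\<dots> = (\<Sum>n<k. a n) + (\<Sum>n<N. a (n + k))"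
    by (induction N) (simp_all add: algebra_simps)
  also have "\<dots> \<le> (\<Sum>n<k. 1) + (\<Sum>n<N. r * a n)"
    using le_1 decay by (intro add_mono sum_mono)
  also have "\<dots> = real k + r * (\<Sum>n<N. a n)"
    by (simp add: sum_distrib_left)
  finally have "(1 - r) * (\<Sum>n<N. a n) \<le> real k"
    by (simp add: algebra_simps)
  then show "(\<Sum>n<N. a n) \<le> real k / (1 - r)"
    using r by (simp add: field_simps)
qed (rule nonneg)

context prob_space
begin

text \<open>Compactness gives a \<open>k\<close> for which the probability on \<open>k\<close>
  vertices is less than 1; each further block of \<open>k\<close> vertices multiplies the
  probability by at most this constant.\<close>

lemma summable_sample_colorable_prob:
  assumes W: "graphon M W" and not_col: "\<not> (\<exists>f. graphon_coloring M W m f)"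
  shows "summable (\<lambda>n. enn2real (sample_colorable_prob W m {1..n}))"
proof -
  have "W \<in> borel_measurable (M \<Otimes>\<^sub>M M)"
    using W by (simp add: graphon_def)
  with not_col obtain k where "\<not> AE_iter M k (extendable W m [])"
    using graphon_coloring_of_finite by blast
  then have less_1: "sample_colorable_prob W m {1..k} < 1"
    using AE_iter_extendable[OF W] sample_colorable_prob_le_1[of W m "{1..k}"] by (auto simp: less_le)
  have fin: "sample_colorable_prob W m J < \<top>" for J
    using sample_colorable_prob_le_1[of W m J] by (auto intro: le_less_trans)
  show ?thesis
  proof (rule summable_of_block_decay)
    fix n
    have image: "{n + 1..n + k} = (+) n ` {1..k}"
      by simp
    have "{1..n + k} = {1..n} \<union> {n + 1..n + k}"
      by auto
    then have "sample_colorable_prob W m {1..n + k} \<le>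
        sample_colorable_prob W m {1..n} * sample_colorable_prob W m {n + 1..n + k}"
      using sample_colorable_prob_Un_le[OF W, of "{1..n}" "{n + 1..n + k}"] by simp
    also have "sample_colorable_prob W m {n + 1..n + k} = sample_colorable_prob W m {1..k}"
      unfolding image by (intro sample_colorable_prob_image W) (auto intro: strict_mono_onI)
    finally have "enn2real (sample_colorable_prob W m {1..n + k}) \<le>
        enn2real (sample_colorable_prob W m {1..n} * sample_colorable_prob W m {1..k})"
      using fin by (intro enn2real_mono) (auto simp: ennreal_mult_less_top)
    then show "enn2real (sample_colorable_prob W m {1..n + k}) \<le>
        enn2real (sample_colorable_prob W m {1..k}) * enn2real (sample_colorable_prob W m {1..n})"
      by (simp add: enn2real_mult mult.commute)
    show "enn2real (sample_colorable_prob W m {1..n}) \<le> 1"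
      using enn2real_mono[OF sample_colorable_prob_le_1] by simp
    show "enn2real (sample_colorable_prob W m {1..k}) < 1"
      using less_1 fin by (metis enn2real_less_iff ennreal_1 zero_le_one)
  qed simp_all
qed

text \<open>The lower and the upper bound hold almost surely for each of countably many thresholds
  \<open>m\<close>, hence for all of them at once.\<close>

lemma graph_chi_W_random_tendsto:
  fixes P :: "'w measure"
  assumes W: "graphon M W" and P: "prob_space P"
    and G: "\<And>n. n \<ge> 1 \<Longrightarrow> G n \<in> measurable P (count_space UNIV)"
    and law: "\<And>n. n \<ge> 1 \<Longrightarrow> distr P (count_space UNIV) (G n) = W_random_graph M W n"
  shows "AE \<omega> in P. (\<lambda>n. graph_chi (G n \<omega>)) \<longlonglongrightarrow> graphon_chi M W"
proof -
  interpret P: prob_space P by fact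
  \<comment> \<open>The index is shifted because the laws of \<open>G\<close> are given from 1
    on.\<close>
  define E where "E m n = {\<omega> \<in> space P. graph_chi (G (Suc n) \<omega>) \<le> enat m}" for m n
  have E_eq: "E m n = G (Suc n) -` {H. graph_chi H \<le> enat m} \<inter> space P" for m n
    by (auto simp: E_def)
  have E[measurable]: "E m n \<in> sets P" for m n
    unfolding E_eq by (rule measurable_sets[OF G]) auto
  have emeasure_E: "emeasure P (E m n) = sample_colorable_prob W m {1..Suc n}" for m n
  proof -
    have "emeasure P (E m n) = emeasure (distr P (count_space UNIV) (G (Suc n))) {H. graph_chi H \<le> enat m}"
      unfolding E_eq by (subst emeasure_distr[OF G]) auto
    also have "distr P (count_space UNIV) (G (Suc n)) = W_random_graph M W (Suc n)"
      by (rule law) simp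
    finally show ?thesis
      unfolding emeasure_W_random_graph[OF W] .
  qed
  \<comment> \<open>The probabilities are summable, so by Borel--Cantelli almost surely only
    finitely many of the graphs are \<open>m\<close>-colorable.\<close>
  have lower: "AE \<omega> in P. enat m < graphon_chi M W \<longrightarrow> (\<forall>\<^sub>F n in sequentially. enat m < graph_chi (G n \<omega>))" for m
  proof (cases "enat m < graphon_chi M W")
    case True
    then have "\<not> (\<exists>f. graphon_coloring M W m f)"
      by (simp flip: graphon_chi_le_iff add: not_le)
    then have "summable (\<lambda>n. enn2real (sample_colorable_prob W m {1..Suc n}))"
      using summable_sample_colorable_prob[OF W] by (subst summable_Suc_iff)
    then have "summable (\<lambda>n. measure P (E m n))"
      by (simp add: measure_def emeasure_E)
    then have "AE \<omega> in P. \<forall>\<^sub>F n in sequentially. \<omega> \<in> space P - E m n"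
      by (intro borel_cantelli_AE1) (auto simp: P.emeasure_eq_measure)
    then show ?thesis
    proof (rule eventually_mono)
      fix \<omega>
      assume "\<forall>\<^sub>F n in sequentially. \<omega> \<in> space P - E m n"
      then have "\<forall>\<^sub>F n in sequentially. enat m < graph_chi (G (Suc n) \<omega>)"
        by (rule eventually_mono) (auto simp: E_def)
      then show "enat m < graphon_chi M W \<longrightarrow> (\<forall>\<^sub>F n in sequentially. enat m < graph_chi (G n \<omega>))"
        by (subst (asm) eventually_sequentially_Suc) simp
    qed
  qed simp
  \<comment> \<open>Once \<open>W\<close> is \<open>m\<close>-colorable, each random graph is so
    with probability 1.\<close>
  have upper: "AE \<omega> in P. graphon_chi M W \<le> enat m \<longrightarrow> graph_chi (G (Suc n) \<omega>) \<le> enat m" for m n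
  proof (cases "graphon_chi M W \<le> enat m")
    case True
    then obtain f where "graphon_coloring M W m f"
      by (auto simp: graphon_chi_le_iff)
    then have "emeasure P (E m n) = 1"
      unfolding emeasure_E by (intro sample_colorable_prob_eq_1[OF W]) auto
    then have "AE \<omega> in P. \<omega> \<in> E m n"
      by (simp add: P.emeasure_eq_measure P.prob_eq_1)
    then show ?thesis
      by (rule eventually_mono) (simp add: E_def)
  qed simp
  have "AE \<omega> in P. \<forall>m. enat m < graphon_chi M W \<longrightarrow> (\<forall>\<^sub>F n in sequentially. enat m < graph_chi (G n \<omega>))"
    using lower by (simp add: AE_all_countable)
  moreover have "AE \<omega> in P. \<forall>m n. graphon_chi M W \<le> enat m \<longrightarrow> graph_chi (G (Suc n) \<omega>) \<le> enat m"
    using upper by (simp add: AE_all_countable)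
  ultimately show ?thesis
  proof eventually_elim
    case (elim \<omega>)
    show ?case
    proof (rule order_tendstoI)
      fix a
      assume "a < graphon_chi M W"
      then show "\<forall>\<^sub>F n in sequentially. a < graph_chi (G n \<omega>)"
        using elim(1) by (cases a) auto
    next
      fix a
      assume a: "graphon_chi M W < a"
      then obtain m where m: "graphon_chi M W = enat m"
        by (cases "graphon_chi M W") auto
      then have "\<forall>n. graph_chi (G (Suc n) \<omega>) < a"
        using elim(2) a by (metis le_less_trans order_refl)
      then have "\<forall>\<^sub>F n in sequentially. graph_chi (G (Suc n) \<omega>) < a"
        by simp
      then show "\<forall>\<^sub>F n in sequentially. graph_chi (G n \<omega>) < a"
        by (subst (asm) eventually_sequentially_Suc)
    qed
  qed
qed

end

theorem theorem4p3:
  fixes M :: "'a measure" and W :: "'a \<times> 'a \<Rightarrow> real"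
  assumes "prob_space M" and "standard_borel M" and "atomless M"
    and "graphon M W"
  shows "(\<forall>H :: nat \<Rightarrow> 'v pair_pre_digraph.
            (\<forall>n. pair_graph (H n)) \<longrightarrow> graphs_converge_cut M H W \<longrightarrow>
            graphon_chi M W \<le> liminf (\<lambda>n. graph_chi (H n)))
       \<and> (\<forall>(P :: 'w measure) (G :: nat \<Rightarrow> 'w \<Rightarrow> nat pair_pre_digraph).
            prob_space P \<longrightarrow>
            (\<forall>n\<ge>1. G n \<in> measurable P (count_space UNIV) \<and>
                    distr P (count_space UNIV) (G n) = W_random_graph M W n) \<longrightarrow>
            (AE \<omega> in P. (\<lambda>n. graph_chi (G n \<omega>)) \<longlonglongrightarrow> graphon_chi M W))"
proof -
  interpret prob_space M by fact
  show ?thesis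
    using graphon_chi_le_liminf[OF assms(4)] graph_chi_W_random_tendsto[OF assms(4)] by blast
qed

end
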